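(* Let $G$ be a spray of scalar curvature on an $n$-dimensional smooth manifold $M$, $n\ge 2$. For any volume form $dV$ on $M$, the spray $\hat G$ associated with $(G,dV)$, i.e. the spray with coefficients $\hat G^i = G^i - \frac{S}{n+1}y^i$ where $S$ is the S-curvature of $(G,dV)$, is of isotropic curvature.
   Context: Summation over repeated indices is used. $(x^i,y^i)$ denotes standard local coordinates on $TM$; $TM\setminus 0$ is the set of non-zero tangent vectors. A spray $G$ on $M$ is a vector field on $TM\setminus 0$ locally of the form $G = y^i\frac{\partial}{\partial x^i} - 2G^i\frac{\partial}{\partial y^i}$, where the $G^i=G^i(x,y)$ (the spray coefficients) are local $C^\infty$ functions on non-zero vectors with $G^i(x,\lambda y)=\lambda^2 G^i(x,y)$ for all $\lambda>0$. Put $N^i_j=\frac{\partial G^i}{\partial y^j}$, $\Gamma^i_{jk}=\frac{\partial^2 G^i}{\partial y^j\partial y^k}$, $\frac{\delta}{\delta x^k}=\frac{\partial}{\partial x^k}-N^m_k\frac{\partial}{\partial y^m}$. The Riemann curvature tensor is $R^{\ i}_{j\ kl} = \frac{\delta\Gamma^i_{jl}}{\delta x^k}-\frac{\delta\Gamma^i_{jk}}{\delta x^l}+\Gamma^i_{ks}\Gamma^s_{jl}-\Gamma^s_{jk}\Gamma^i_{ls}$, and $R^i_{\ k}=y^jR^{\ i}_{j\ kl}y^l$. Put $R=\frac{1}{n-1}R^m_{\ m}$. A subscript $\cdot k$ denotes $\frac{\partial}{\partial y^k}$. $G$ is of scalar curvature if $R^i_{\ k}=R\,\delta^i_{\ k}-\tau_k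 y^i$, where $\tau_k$ is positively homogeneous of degree one in $y$ with $\tau_ky^k=R$. $G$ is of isotropic curvature if $R^i_{\ k}=R\,\delta^i_{\ k}-\frac12R_{\cdot k}y^i$. For a volume form $dV=\sigma(x)\,dx^1\cdots dx^n$ ($\sigma>0$), the S-curvature of $(G,dV)$ is $S=\frac{\partial G^m}{\partial y^m}-y^m\frac{\partial}{\partial x^m}(\ln\sigma)$. *)

theory Defs
  imports "HOL-Analysis.Analysis"
begin

section \<open>Smooth maps and manifolds\<close>

text \<open>
  C^k and C-infinity maps on an open subset of a normed space; in the recursive clause the
  derivatives in all directions are required to be of class C^k.
\<close>

primrec Ck_on :: "nat \<Rightarrow> 'a::real_normed_vector set \<Rightarrow> ('a \<Rightarrow> 'b::real_normed_vector) \<Rightarrow> bool" where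
  "Ck_on 0 S f \<longleftrightarrow> continuous_on S f"
| "Ck_on (Suc k) S f \<longleftrightarrow>
     (\<forall>x\<in>S. f differentiable (at x)) \<and>
     (\<forall>v. Ck_on k S (\<lambda>x. frechet_derivative f (at x) v))"

definition smooth_on :: "'a::real_normed_vector set \<Rightarrow> ('a \<Rightarrow> 'b::real_normed_vector) \<Rightarrow> bool" where
  "smooth_on S f \<longleftrightarrow> (\<forall>k. Ck_on k S f)"

text \<open>
  A manifold is given by an indexed atlas with model space \<open>'e\<close>: \<open>coord M c\<close> is the coordinate
  map of the chart \<open>c\<close>, relevant only on \<open>chart_dom M c\<close>. The atlas need not be maximal.
\<close>

record ('p, 'c, 'e) atlas =
  points :: "'p set"
  charts :: "'c set"
  chart_dom :: "'c \<Rightarrow> 'p set"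
  coord :: "'c \<Rightarrow> 'p \<Rightarrow> 'e"

definition chart_inv :: "('p, 'c, 'e) atlas \<Rightarrow> 'c \<Rightarrow> 'e \<Rightarrow> 'p" where
  "chart_inv M c = inv_into (chart_dom M c) (coord M c)"

definition transition :: "('p, 'c, 'e) atlas \<Rightarrow> 'c \<Rightarrow> 'c \<Rightarrow> 'e \<Rightarrow> 'e" where
  "transition M c d = coord M d \<circ> chart_inv M c"

definition atlas_topology :: "('p, 'c, 'e::topological_space) atlas \<Rightarrow> 'p topology" where
  "atlas_topology M =
     topology_generated_by {chart_dom M c \<inter> coord M c -` U | c U. c \<in> charts M \<and> open U}"

definition smooth_manifold :: "('p, 'c, 'e::euclidean_space) atlas \<Rightarrow> bool" where
  "smooth_manifold M \<longleftrightarrow>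
     (\<Union>c\<in>charts M. chart_dom M c) = points M \<and>
     (\<forall>c\<in>charts M. inj_on (coord M c) (chart_dom M c)) \<and>
     (\<forall>c\<in>charts M. \<forall>d\<in>charts M.
        open (coord M c ` (chart_dom M c \<inter> chart_dom M d)) \<and>
        smooth_on (coord M c ` (chart_dom M c \<inter> chart_dom M d)) (transition M c d)) \<and>
     Hausdorff_space (atlas_topology M) \<and>
     second_countable (atlas_topology M)"

section \<open>Tangent vectors and vector fields\<close>

text \<open>
  A tangent vector at \<open>p\<close> is the family of its component vectors in all charts around \<open>p\<close>, related
  by the differentials of the coordinate changes. The value 0 for the remaining indices makes the
  representation unique.
\<close>

definition tangent_space :: "('p, 'c, 'e::euclidean_space) atlas \<Rightarrow> 'p \<Rightarrow> ('c \<Rightarrow> 'e) set" where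
  "tangent_space M p =
     {v. (\<forall>c. c \<notin> charts M \<or> p \<notin> chart_dom M c \<longrightarrow> v c = 0) \<and>
         (\<forall>c\<in>charts M. \<forall>d\<in>charts M. p \<in> chart_dom M c \<inter> chart_dom M d \<longrightarrow>
            v d = frechet_derivative (transition M c d) (at (coord M c p)) (v c))}"

text \<open>
  The slit tangent bundle \<open>TM - 0\<close> with its standard charts, which have the same indices as those
  of \<open>M\<close>: the chart \<open>c\<close> sends a tangent vector to its coordinates \<open>(x, y)\<close>.
\<close>

definition slit_tangent ::
    "('p, 'c, 'e::euclidean_space) atlas \<Rightarrow> ('p \<times> ('c \<Rightarrow> 'e), 'c, 'e \<times> 'e) atlas" where
  "slit_tangent M =
     (let N = {(p, v). p \<in> points M \<and> v \<in> tangent_space M p \<and> v \<noteq> (\<lambda>_. 0)} in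
      \<lparr> points = N,
        charts = charts M,
        chart_dom = (\<lambda>c. {(p, v) \<in> N. p \<in> chart_dom M c}),
        coord = (\<lambda>c (p, v). (coord M c p, v c)) \<rparr>)"

definition local_rep :: "('p, 'c, 'e) atlas \<Rightarrow> ('p \<Rightarrow> 'c \<Rightarrow> 'f) \<Rightarrow> 'c \<Rightarrow> 'e \<Rightarrow> 'f" where
  "local_rep M X c z = X (chart_inv M c z) c"

definition vector_field :: "('p, 'c, 'e::euclidean_space) atlas \<Rightarrow> ('p \<Rightarrow> 'c \<Rightarrow> 'e) \<Rightarrow> bool" where
  "vector_field M X \<longleftrightarrow>
     (\<forall>p\<in>points M. X p \<in> tangent_space M p) \<and>
     (\<forall>c\<in>charts M. smooth_on (coord M c ` chart_dom M c) (local_rep M X c))"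

section \<open>Sprays\<close>

definition slit_image :: "('p, 'c, 'e::euclidean_space) atlas \<Rightarrow> 'c \<Rightarrow> ('e \<times> 'e) set" where
  "slit_image M c = coord (slit_tangent M) c ` chart_dom (slit_tangent M) c"

text \<open>
  The components of a spray in the chart \<open>c\<close> of \<open>TM - 0\<close> are \<open>(y, - 2 G(x, y))\<close>, where \<open>G\<close> is the
  vector of its spray coefficients.
\<close>

definition spray_coeff ::
    "('p, 'c, 'e::euclidean_space) atlas \<Rightarrow> ('p \<times> ('c \<Rightarrow> 'e) \<Rightarrow> 'c \<Rightarrow> 'e \<times> 'e) \<Rightarrow> 'c \<Rightarrow> 'e \<times> 'e \<Rightarrow> 'e" where
  "spray_coeff M G c z = - (1 / 2) *\<^sub>R snd (local_rep (slit_tangent M) G c z)"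

definition spray ::
    "('p, 'c, 'e::euclidean_space) atlas \<Rightarrow> ('p \<times> ('c \<Rightarrow> 'e) \<Rightarrow> 'c \<Rightarrow> 'e \<times> 'e) \<Rightarrow> bool" where
  "spray M G \<longleftrightarrow>
     vector_field (slit_tangent M) G \<and>
     (\<forall>c\<in>charts M. \<forall>(x, y)\<in>slit_image M c.
        fst (local_rep (slit_tangent M) G c (x, y)) = y \<and>
        (\<forall>l>0. spray_coeff M G c (x, l *\<^sub>R y) = l\<^sup>2 *\<^sub>R spray_coeff M G c (x, y)))"

section \<open>Curvature in local coordinates\<close>

definition dx :: "'n \<Rightarrow> ((real^'n) \<times> (real^'n) \<Rightarrow> real) \<Rightarrow> (real^'n) \<times> (real^'n) \<Rightarrow> real" where
  "dx k f z = frechet_derivative f (at z) (axis k 1, 0)"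

definition dy :: "'n \<Rightarrow> ((real^'n) \<times> (real^'n) \<Rightarrow> real) \<Rightarrow> (real^'n) \<times> (real^'n) \<Rightarrow> real" where
  "dy k f z = frechet_derivative f (at z) (0, axis k 1)"

context
  fixes H :: "(real^'n) \<times> (real^'n) \<Rightarrow> real^'n"
begin

definition spray_N :: "'n \<Rightarrow> 'n \<Rightarrow> (real^'n) \<times> (real^'n) \<Rightarrow> real" where
  "spray_N i j = dy j (\<lambda>z. H z $ i)"

definition spray_Gamma :: "'n \<Rightarrow> 'n \<Rightarrow> 'n \<Rightarrow> (real^'n) \<times> (real^'n) \<Rightarrow> real" where
  "spray_Gamma i j k = dy j (dy k (\<lambda>z. H z $ i))"

definition spray_delta ::
    "'n \<Rightarrow> ((real^'n) \<times> (real^'n) \<Rightarrow> real) \<Rightarrow> (real^'n) \<times> (real^'n) \<Rightarrow> real" where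
  "spray_delta k f z = dx k f z - (\<Sum>m\<in>UNIV. spray_N m k z * dy m f z)"

text \<open>The upper index comes first in \<open>riemann4 i j k l\<close> and \<open>riemann2 i k\<close>.\<close>

definition riemann4 :: "'n \<Rightarrow> 'n \<Rightarrow> 'n \<Rightarrow> 'n \<Rightarrow> (real^'n) \<times> (real^'n) \<Rightarrow> real" where
  "riemann4 i j k l z =
     spray_delta k (spray_Gamma i j l) z - spray_delta l (spray_Gamma i j k) z
     + (\<Sum>s\<in>UNIV. spray_Gamma i k s z * spray_Gamma s j l z)
     - (\<Sum>s\<in>UNIV. spray_Gamma s j k z * spray_Gamma i l s z)"

definition riemann2 :: "'n \<Rightarrow> 'n \<Rightarrow> (real^'n) \<times> (real^'n) \<Rightarrow> real" where
  "riemann2 i k z = (\<Sum>j\<in>UNIV. \<Sum>l\<in>UNIV. snd z $ j * riemann4 i j k l z * snd z $ l)"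

definition ricci_scalar :: "(real^'n) \<times> (real^'n) \<Rightarrow> real" where
  "ricci_scalar z = (1 / (real CARD('n) - 1)) * (\<Sum>m\<in>UNIV. riemann2 m m z)"

end

text \<open>
  The factor \<open>\<tau>\<close> may be chosen chart by chart: since \<open>y\<close> does not vanish, it is uniquely determined.
\<close>

definition scalar_curvature ::
    "('p, 'c, real^'n) atlas \<Rightarrow> ('p \<times> ('c \<Rightarrow> real^'n) \<Rightarrow> 'c \<Rightarrow> (real^'n) \<times> (real^'n)) \<Rightarrow> bool" where
  "scalar_curvature M G \<longleftrightarrow>
     (\<forall>c\<in>charts M. \<exists>\<tau> :: 'n \<Rightarrow> (real^'n) \<times> (real^'n) \<Rightarrow> real.
        \<forall>(x, y)\<in>slit_image M c.
          (\<forall>k. \<forall>l>0. \<tau> k (x, l *\<^sub>R y) = l * \<tau> k (x, y)) \<and>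
          (\<Sum>k\<in>UNIV. \<tau> k (x, y) * y $ k) = ricci_scalar (spray_coeff M G c) (x, y) \<and>
          (\<forall>i k. riemann2 (spray_coeff M G c) i k (x, y) =
             ricci_scalar (spray_coeff M G c) (x, y) * (if i = k then 1 else 0)
             - \<tau> k (x, y) * y $ i))"

definition isotropic_curvature ::
    "('p, 'c, real^'n) atlas \<Rightarrow> ('p \<times> ('c \<Rightarrow> real^'n) \<Rightarrow> 'c \<Rightarrow> (real^'n) \<times> (real^'n)) \<Rightarrow> bool" where
  "isotropic_curvature M G \<longleftrightarrow>
     (\<forall>c\<in>charts M. \<forall>(x, y)\<in>slit_image M c. \<forall>i k.
        riemann2 (spray_coeff M G c) i k (x, y) =
          ricci_scalar (spray_coeff M G c) (x, y) * (if i = k then 1 else 0)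
          - 1 / 2 * dy k (ricci_scalar (spray_coeff M G c)) (x, y) * y $ i)"

section \<open>Volume forms and the S-curvature\<close>

text \<open>
  A volume form is given by its positive coefficients \<open>\<sigma>\<close> with respect to \<open>dx^1 ... dx^n\<close> in all
  charts. Since positivity is required in every chart, the coefficients change with the absolute
  value of the Jacobian; no orientability is assumed. When all coordinate changes preserve the
  orientation, these are the positive n-forms.
\<close>

definition volume_form :: "('p, 'c, real^'n) atlas \<Rightarrow> ('p \<Rightarrow> 'c \<Rightarrow> real) \<Rightarrow> bool" where
  "volume_form M dV \<longleftrightarrow>
     (\<forall>c\<in>charts M. \<forall>p\<in>chart_dom M c. dV p c > 0) \<and>
     (\<forall>c\<in>charts M. \<forall>d\<in>charts M. \<forall>p\<in>chart_dom M c \<inter> chart_dom M d.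
        dV p c =
          \<bar>det (matrix (frechet_derivative (transition M c d) (at (coord M c p))))\<bar> * dV p d) \<and>
     (\<forall>c\<in>charts M. smooth_on (coord M c ` chart_dom M c) (local_rep M dV c))"

definition S_curvature ::
    "('p, 'c, real^'n) atlas \<Rightarrow> ('p \<times> ('c \<Rightarrow> real^'n) \<Rightarrow> 'c \<Rightarrow> (real^'n) \<times> (real^'n)) \<Rightarrow>
     ('p \<Rightarrow> 'c \<Rightarrow> real) \<Rightarrow> 'c \<Rightarrow> (real^'n) \<times> (real^'n) \<Rightarrow> real" where
  "S_curvature M G dV c = (\<lambda>(x, y).
     (\<Sum>m\<in>UNIV. dy m (\<lambda>z. spray_coeff M G c z $ m) (x, y))
     - (\<Sum>m\<in>UNIV. y $ m *
          frechet_derivative (\<lambda>x. ln (local_rep M dV c x)) (at x) (axis m 1)))"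

text \<open>
  The spray with coefficients \<open>G^i - S / (n + 1) y^i\<close>, as a vector field on \<open>TM - 0\<close>. That these
  local expressions define a spray is not part of the definition.
\<close>

definition associated_spray ::
    "('p, 'c, real^'n) atlas \<Rightarrow> ('p \<times> ('c \<Rightarrow> real^'n) \<Rightarrow> 'c \<Rightarrow> (real^'n) \<times> (real^'n)) \<Rightarrow>
     ('p \<Rightarrow> 'c \<Rightarrow> real) \<Rightarrow> 'p \<times> ('c \<Rightarrow> real^'n) \<Rightarrow> 'c \<Rightarrow> (real^'n) \<times> (real^'n)" where
  "associated_spray M G dV u c =
     (if c \<in> charts M \<and> u \<in> chart_dom (slit_tangent M) c then
        let z = coord (slit_tangent M) c u; y = snd z in
        (y, - 2 *\<^sub>R (spray_coeff M G c z
                     - (S_curvature M G dV c z / (real CARD('n) + 1)) *\<^sub>R y))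
      else 0)"

end

theory Submission
  imports Defs
begin

text \<open>
  Berwald's formula expresses the Riemann curvature \<open>R^i_k\<close> of a spray through second derivatives of
  its coefficients. It shows that adding \<open>P y^i\<close> to the coefficients changes \<open>R^i_k\<close> only by a multiple
  of \<open>\<delta>^i_k\<close> and a multiple of \<open>y^i\<close>, so the associated spray is again of the form
  \<open>R \<delta>^i_k - \<tau>_k y^i\<close>. With \<open>\<Pi> = \<partial>G^m/\<partial>y^m\<close>, it also yields
  \<open>2 R^m_k.m + R^m_m.k = 3 \<partial>\<Pi>/\<partial>x^k - 3 y^j \<partial>\<Pi>_.k/\<partial>x^j + 6 G^j \<Pi>_.k.j\<close>. Subtracting
  \<open>S y^i / (n + 1)\<close> makes the S-curvature vanish, that is, \<open>\<Pi> = y^m \<partial>(ln \<sigma>)/\<partial>x^m\<close>, and then the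
  right-hand side is 0. Since \<open>\<tau>\<close> is homogeneous of degree one, the left-hand side is
  \<open>(n + 1) (R_.k - 2 \<tau>_k)\<close>, hence \<open>\<tau>_k = R_.k / 2\<close>.

  That the associated coefficients define a spray on \<open>M\<close> amounts to \<open>S\<close> being a scalar: under a change
  of coordinates, the trace of the second derivative produced by \<open>\<partial>G^m/\<partial>y^m\<close> cancels against the
  logarithmic derivative of the Jacobian determinant produced by \<open>\<sigma>\<close>.
\<close>

section \<open>Calculus of smooth functions\<close>

text \<open>The hypothesis gives \<tau> only as a function with pointwise properties, without
  smoothness, and the projective change adds a further such factor. The trace identity, however,
  differentiates R^i_k. So \<tau> is rebuilt from R^i_k itself, by contraction with y in the
  Euclidean way of a chart; the result is smooth because y does not vanish on TM - 0. Its degree and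
  \<tau>_k y^k = R are then recovered from R^i_k y^k = 0 and from the degree two of R^i_k.

  The weights 2 and 1 of the two traces are forced up to a common factor: each trace alone contains
  \<partial>N^m_k/\<partial>x^m and products of N with \<Gamma>, and these cancel for this ratio
  only. What remains, \<partial>\<Pi>/\<partial>x^k - y^j \<partial>\<Pi>_.k/\<partial>x^j + 2 G^j
  \<Pi>_.k.j, is up to sign the Euler-Lagrange expression of \<Pi> along the geodesics of the spray.
  The function y^m \<partial>(ln \<sigma>)/\<partial>x^m is the derivative of ln \<sigma> along a
  curve, a null Lagrangian; this is why it makes the expression vanish whatever the spray
  is.\<close>

lemma has_derivative_frechet:
  "f differentiable (at x) \<Longrightarrow> (f has_derivative frechet_derivative f (at x)) (at x)"
  by (simp add: frechet_derivative_works)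

lemma frechet_eqI:
  "(f has_derivative f') (at x) \<Longrightarrow> frechet_derivative f (at x) = f'"
  by (metis frechet_derivative_at)

text \<open>No differentiability is assumed: functions that agree near \<open>x\<close> have the
  same derivatives there, so the choice operator behind \<open>frechet_derivative\<close> is applied
  to the same predicate.\<close>

lemma frechet_cong:
  assumes "open S" "x \<in> S" "\<And>y. y \<in> S \<Longrightarrow> f y = g y"
  shows "frechet_derivative f (at x) = frechet_derivative g (at x)"
proof -
  have "(f has_derivative D) (at x) = (g has_derivative D) (at x)" for D
    using assms has_derivative_transform_within_open[of f D x UNIV S g]
      has_derivative_transform_within_open[of g D x UNIV S f] by auto
  then show ?thesis unfolding frechet_derivative_def by simp
qed

lemma differentiable_cong_open:
  assumes "open S" "x \<in> S" "\<And>y. y \<in> S \<Longrightarrow> f y = g y"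
  shows "f differentiable (at x) \<longleftrightarrow> g differentiable (at x)"
  using assms has_derivative_transform_within_open[of f _ x UNIV S g]
      has_derivative_transform_within_open[of g _ x UNIV S f] unfolding differentiable_def by metis

lemma Ck_on_cong:
  assumes "open S" "\<And>x. x \<in> S \<Longrightarrow> f x = g x"
  shows "Ck_on k S f \<longleftrightarrow> Ck_on k S g"
  using assms
proof (induction k arbitrary: f g)
  case 0
  then show ?case using continuous_on_cong[of S S f g] by simp
next
  case (Suc k)
  have "Ck_on k S (\<lambda>x. frechet_derivative f (at x) v) \<longleftrightarrow>
      Ck_on k S (\<lambda>x. frechet_derivative g (at x) v)" for v
    using Suc.prems frechet_cong[of S _ f g] by (intro Suc.IH) auto
  then show ?case using differentiable_cong_open[of S _ f g] Suc.prems by auto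
qed

lemma Ck_on_Suc_imp: "Ck_on (Suc k) S f \<Longrightarrow> Ck_on k S f"
proof (induction k arbitrary: f)
  case 0
  then show ?case
    by (auto simp: continuous_on_eq_continuous_within intro!: differentiable_imp_continuous_within
        intro: differentiable_at_withinI)
next
  case (Suc k)
  from Suc.prems have "\<forall>x\<in>S. f differentiable (at x)"
    and *: "\<And>v. Ck_on (Suc k) S (\<lambda>x. frechet_derivative f (at x) v)" by auto
  then show ?case using Suc.IH[OF *] by auto
qed

text \<open>Frees the smoothness proofs from \<open>frechet_derivative\<close>: any formula for the
  derivative on the open set may serve in the recursive clause of \<open>Ck_on\<close>.\<close>

lemma Ck_on_SucI:
  assumes "open S" "\<And>x. x \<in> S \<Longrightarrow> (f has_derivative f' x) (at x)"
    and "\<And>v. Ck_on k S (\<lambda>x. f' x v)"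
  shows "Ck_on (Suc k) S f"
proof -
  have "Ck_on k S (\<lambda>x. frechet_derivative f (at x) v)" for v
    using Ck_on_cong[OF assms(1), of "\<lambda>x. frechet_derivative f (at x) v" "\<lambda>x. f' x v" k]
      assms frechet_eqI by metis
  then show ?thesis using assms(2) by (auto simp: differentiable_def)
qed

lemma Ck_on_SucD:
  assumes "Ck_on (Suc k) S f"
  shows "\<And>x. x \<in> S \<Longrightarrow> (f has_derivative frechet_derivative f (at x)) (at x)"
    and "\<And>v. Ck_on k S (\<lambda>x. frechet_derivative f (at x) v)"
  using assms by (auto intro: has_derivative_frechet)

lemma Ck_on_const: "open S \<Longrightarrow> Ck_on k S (\<lambda>x. c)"
proof (induction k arbitrary: c)
  case (Suc k)
  then show ?case by (intro Ck_on_SucI[where f' = "\<lambda>x v. 0"]) auto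
qed auto

lemma Ck_on_bounded_linear:
  assumes "bounded_linear f" "open S" shows "Ck_on k S f"
proof (cases k)
  case 0
  then show ?thesis using assms linear_continuous_on by auto
next
  case (Suc l)
  then show ?thesis using assms Ck_on_const
    by (auto intro!: Ck_on_SucI[where f' = "\<lambda>x. f"] bounded_linear_imp_has_derivative simp del: Ck_on.simps)
qed

lemma Ck_on_linear_compose:
  assumes "bounded_linear L" "open S" "Ck_on k S f"
  shows "Ck_on k S (\<lambda>x. L (f x))"
  using assms(3)
proof (induction k arbitrary: f)
  case 0
  then show ?case using assms bounded_linear.continuous_on by auto
next
  case (Suc k)
  note * = Ck_on_SucD[OF Suc.prems]
  show ?case
    by (rule Ck_on_SucI[where f' = "\<lambda>x v. L (frechet_derivative f (at x) v)"])
      (use * assms Suc.IH bounded_linear.has_derivative in blast)+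
qed

lemma Ck_on_compose_linear:
  assumes "bounded_linear L" "open S" "open T" "L ` T \<subseteq> S" "Ck_on k S f"
  shows "Ck_on k T (\<lambda>x. f (L x))"
  using assms(5)
proof (induction k arbitrary: f)
  case 0
  then show ?case using assms linear_continuous_on[of L] continuous_on_compose2[of S f T L] by auto
next
  case (Suc k)
  note * = Ck_on_SucD[OF Suc.prems]
  have "((\<lambda>x. f (L x)) has_derivative (\<lambda>v. frechet_derivative f (at (L x)) (L v))) (at x)" if "x \<in> T" for x
    using has_derivative_compose[OF bounded_linear_imp_has_derivative[OF assms(1)] *(1)] that assms(4)
    by blast
  then show ?case using assms(3) *(2) Suc.IH
    by (intro Ck_on_SucI[where f' = "\<lambda>x v. frechet_derivative f (at (L x)) (L v)"]) auto
qed

lemma Ck_on_add: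
  assumes "open S" "Ck_on k S f" "Ck_on k S g"
  shows "Ck_on k S (\<lambda>x. f x + g x)"
  using assms(2,3)
proof (induction k arbitrary: f g)
  case 0
  then show ?case by (auto intro: continuous_on_add)
next
  case (Suc k)
  note * = Ck_on_SucD[OF Suc.prems(1)] Ck_on_SucD[OF Suc.prems(2)]
  show ?case
    by (rule Ck_on_SucI[where f' = "\<lambda>x v. frechet_derivative f (at x) v + frechet_derivative g (at x) v"])
      (use * assms(1) Suc.IH has_derivative_add in blast)+
qed

text \<open>One product rule for products and scalar multiples. The derivative contains
  \<open>f\<close> and \<open>g\<close> undifferentiated; these come down to order k by
  \<open>Ck_on_Suc_imp\<close>.\<close>

lemma Ck_on_bilinear:
  assumes "bounded_bilinear B" "open S" "Ck_on k S f" "Ck_on k S g"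
  shows "Ck_on k S (\<lambda>x. B (f x) (g x))"
  using assms(3,4)
proof (induction k arbitrary: f g)
  case 0
  then show ?case using assms(1) bounded_bilinear.continuous_on by auto
next
  case (Suc k)
  note * = Ck_on_SucD[OF Suc.prems(1)] Ck_on_SucD[OF Suc.prems(2)]
  show ?case
    by (rule Ck_on_SucI[where f' = "\<lambda>x v. B (f x) (frechet_derivative g (at x) v)
         + B (frechet_derivative f (at x) v) (g x)"])
      (use assms(1,2) in \<open>auto intro!: Ck_on_add Suc.IH bounded_bilinear.FDERIV * Ck_on_Suc_imp[OF Suc.prems(1)]
         Ck_on_Suc_imp[OF Suc.prems(2)]\<close>)
qed

lemma smooth_on_Ck: "smooth_on S f \<Longrightarrow> Ck_on k S f" by (simp add: smooth_on_def)

lemma smooth_on_cong: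
  "open S \<Longrightarrow> (\<And>x. x \<in> S \<Longrightarrow> f x = g x) \<Longrightarrow> smooth_on S f \<longleftrightarrow> smooth_on S g"
  unfolding smooth_on_def using Ck_on_cong by metis

lemma smooth_on_has_derivative:
  "smooth_on S f \<Longrightarrow> x \<in> S \<Longrightarrow> (f has_derivative frechet_derivative f (at x)) (at x)"
  by (meson Ck_on_SucD(1) smooth_on_Ck)

lemma smooth_on_derivative:
  "smooth_on S f \<Longrightarrow> smooth_on S (\<lambda>x. frechet_derivative f (at x) v)"
  unfolding smooth_on_def using Ck_on_SucD(2) by blast

lemma smooth_on_const: "open S \<Longrightarrow> smooth_on S (\<lambda>x. c)"
  by (simp add: smooth_on_def Ck_on_const)

lemma smooth_on_bounded_linear: "bounded_linear f \<Longrightarrow> open S \<Longrightarrow> smooth_on S f"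
  by (simp add: smooth_on_def Ck_on_bounded_linear)

lemma smooth_on_linear_compose:
  "bounded_linear L \<Longrightarrow> open S \<Longrightarrow> smooth_on S f \<Longrightarrow> smooth_on S (\<lambda>x. L (f x))"
  by (simp add: smooth_on_def Ck_on_linear_compose)

lemma smooth_on_compose_linear:
  "bounded_linear L \<Longrightarrow> open S \<Longrightarrow> open T \<Longrightarrow> L ` T \<subseteq> S \<Longrightarrow> smooth_on S f \<Longrightarrow>
    smooth_on T (\<lambda>x. f (L x))"
  unfolding smooth_on_def using Ck_on_compose_linear by blast

lemma smooth_on_add:
  "open S \<Longrightarrow> smooth_on S f \<Longrightarrow> smooth_on S g \<Longrightarrow> smooth_on S (\<lambda>x. f x + g x)"
  by (simp add: smooth_on_def Ck_on_add)

lemma smooth_on_bilinear: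
  "bounded_bilinear B \<Longrightarrow> open S \<Longrightarrow> smooth_on S f \<Longrightarrow> smooth_on S g \<Longrightarrow>
    smooth_on S (\<lambda>x. B (f x) (g x))"
  by (simp add: smooth_on_def Ck_on_bilinear)

lemmas smooth_on_scaleR = smooth_on_bilinear[OF bounded_bilinear_scaleR]
lemmas smooth_on_mult = smooth_on_bilinear[OF bounded_bilinear_mult]

lemma smooth_on_minus: "open S \<Longrightarrow> smooth_on S f \<Longrightarrow> smooth_on S (\<lambda>x. - f x)"
  by (rule smooth_on_linear_compose[OF bounded_linear_minus[OF bounded_linear_ident]])

lemma smooth_on_diff:
  "open S \<Longrightarrow> smooth_on S f \<Longrightarrow> smooth_on S g \<Longrightarrow> smooth_on S (\<lambda>x. f x - g x)"
  using smooth_on_add[of S f "\<lambda>x. - g x"] smooth_on_minus[of S g] by simp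

lemma smooth_on_sum:
  assumes "open S" "\<And>i. i \<in> I \<Longrightarrow> smooth_on S (f i)"
  shows "smooth_on S (\<lambda>x. \<Sum>i\<in>I. f i x)"
  using assms(2)
  by (induction I rule: infinite_finite_induct) (auto intro!: smooth_on_const smooth_on_add assms(1))

lemma smooth_on_Pair:
  assumes "open S" "smooth_on S f" "smooth_on S g"
  shows "smooth_on S (\<lambda>x. (f x, g x))"
proof -
  have "smooth_on S (\<lambda>x. (f x, 0) + (0, g x))"
    by (intro smooth_on_add assms(1) smooth_on_linear_compose[OF _ _ assms(2)]
        smooth_on_linear_compose[OF _ _ assms(3)])
      (auto intro!: bounded_linear_Pair bounded_linear_ident bounded_linear_zero)
  then show ?thesis by simp
qed

text \<open>The derivative of 1/f contains 1/f again, which the induction on the order supplies,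
  while f is smooth from the start. This avoids a chain rule for \<open>Ck_on\<close>.\<close>

lemma smooth_on_inverse:
  fixes f :: "'a::real_normed_vector \<Rightarrow> real"
  assumes "open S" "smooth_on S f" "\<And>x. x \<in> S \<Longrightarrow> f x \<noteq> 0"
  shows "smooth_on S (\<lambda>x. inverse (f x))"
proof -
  have "Ck_on k S (\<lambda>x. inverse (f x))" for k
  proof (induction k)
    case 0
    then show ?case using smooth_on_Ck[OF assms(2), of 0] assms(3) by (auto intro: continuous_on_inverse)
  next
    case (Suc k)
    show ?case
      by (rule Ck_on_SucI[where f' = "\<lambda>x v. - (inverse (f x) * frechet_derivative f (at x) v * inverse (f x))"])
        (use assms Suc in \<open>auto intro!: Ck_on_linear_compose[OF bounded_linear_minus[OF bounded_linear_ident]]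
         Ck_on_bilinear[OF bounded_bilinear_mult] smooth_on_Ck[OF smooth_on_derivative] Deriv.has_derivative_inverse
          smooth_on_has_derivative\<close>)
  qed
  then show ?thesis by (simp add: smooth_on_def)
qed

lemma smooth_on_ln:
  fixes f :: "'a::real_normed_vector \<Rightarrow> real"
  assumes "open S" "smooth_on S f" "\<And>x. x \<in> S \<Longrightarrow> f x > 0"
  shows "smooth_on S (\<lambda>x. ln (f x))"
proof -
  have inv: "smooth_on S (\<lambda>x. inverse (f x))"
    using assms by (intro smooth_on_inverse) (auto simp: less_imp_neq dest!: assms(3))
  \<comment> \<open>The derivative f'/f is free of the logarithm, so order k + 1 follows directly
    from the smoothness of f and 1/f.\<close>
  have "Ck_on (Suc k) S (\<lambda>x. ln (f x))" for k
  proof (rule Ck_on_SucI[where f' = "\<lambda>x v. frechet_derivative f (at x) v * inverse (f x)"])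
    fix x assume "x \<in> S"
    then show "((\<lambda>x. ln (f x)) has_derivative (\<lambda>v. frechet_derivative f (at x) v * inverse (f x))) (at x)"
      using has_derivative_ln[OF assms(3) smooth_on_has_derivative[OF assms(2)]] by blast
  qed (auto intro!: smooth_on_Ck smooth_on_mult inv smooth_on_derivative assms)
  then show ?thesis unfolding smooth_on_def using Ck_on_Suc_imp by blast
qed

text \<open>Schwarz's theorem, for two arbitrary directions so that one statement covers x with x, y
  with y and x with y. The second difference \<open>\<Delta> h\<close> over a parallelogram is
  symmetric in the two directions and is evaluated in both orders; continuity of the second
  derivatives lets h shrink to 0.\<close>

lemma frechet_commute:
  fixes f :: "'a::real_normed_vector \<Rightarrow> real"
  assumes "open S" "smooth_on S f" "z \<in> S"
  shows "frechet_derivative (\<lambda>x. frechet_derivative f (at x) b) (at z) a =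
    frechet_derivative (\<lambda>x. frechet_derivative f (at x) a) (at z) b"
proof -
  define D where "D a x = frechet_derivative f (at x) a" for a x
  define D2 where "D2 a b x = frechet_derivative (D b) (at x) a" for a b x
  have smD: "smooth_on S (D a)" for a
    unfolding D_def by (rule smooth_on_derivative[OF assms(2)])
  have cont: "continuous_on S (D2 a b)" for a b
    using smooth_on_Ck[OF smooth_on_derivative[OF smD[of b], of a], of 0]
    by (simp add: D2_def[abs_def])
  have dline: "((\<lambda>t. g (p + t *\<^sub>R w)) has_real_derivative frechet_derivative g (at (p + t *\<^sub>R w)) w) (at t)"
    if "smooth_on S g" "p + t *\<^sub>R w \<in> S" for g :: "'a \<Rightarrow> real" and p w t
  proof -
    have "((\<lambda>t. p + t *\<^sub>R w) has_derivative (\<lambda>t. t *\<^sub>R w)) (at t)"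
      by (auto intro!: derivative_eq_intros)
    from has_derivative_compose[OF this smooth_on_has_derivative[OF that]]
    have "((\<lambda>t. g (p + t *\<^sub>R w)) has_derivative (\<lambda>s. frechet_derivative g (at (p + t *\<^sub>R w)) (s *\<^sub>R w))) (at t)" .
    moreover have "linear (frechet_derivative g (at (p + t *\<^sub>R w)))"
      using smooth_on_has_derivative[OF that] has_derivative_linear by blast
    ultimately show ?thesis
      by (simp add: has_field_derivative_def linear_cmul mult.commute[of _ "frechet_derivative _ _ _"])
  qed
  obtain r where r: "r > 0" "ball z r \<subseteq> S" using assms openE by blast
  \<comment> \<open>The summand 1 keeps the denominator positive when a = b = 0. For h < \<delta>
    the parallelogram spanned by h a and h b at z stays in the ball of radius r.\<close>
  define \<delta> where "\<delta> = r / (norm a + norm b + 1)"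
  have \<delta>: "\<delta> > 0" using r by (simp add: \<delta>_def add_nonneg_pos)
  have inS: "z + s *\<^sub>R u + t *\<^sub>R w \<in> S \<and> norm (s *\<^sub>R u + t *\<^sub>R w) \<le> h * (norm a + norm b)"
    if "0 \<le> s" "s \<le> h" "0 \<le> t" "t \<le> h" "h < \<delta>" "(u,w) = (a,b) \<or> (u,w) = (b,a)" for s t h u w
  proof -
    have "norm (s *\<^sub>R u + t *\<^sub>R w) \<le> s * norm u + t * norm w"
      using that norm_triangle_ineq[of "s *\<^sub>R u" "t *\<^sub>R w"] by simp
    also have "\<dots> \<le> h * norm u + h * norm w" using that by (intro add_mono mult_right_mono) auto
    also have "\<dots> = h * (norm a + norm b)" using that(6) by (auto simp: algebra_simps)
    finally have 1: "norm (s *\<^sub>R u + t *\<^sub>R w) \<le> h * (norm a + norm b)" .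
    also have "\<dots> \<le> h * (norm a + norm b + 1)" using that by (simp add: algebra_simps)
    also have "\<dots> < \<delta> * (norm a + norm b + 1)" using that by (intro mult_strict_right_mono) (auto simp: add_nonneg_pos)
    also have "\<dots> = r" by (simp add: \<delta>_def) (smt (verit) norm_ge_zero)
    finally have "z + s *\<^sub>R u + t *\<^sub>R w \<in> ball z r" by (subst mem_ball, subst dist_commute) (simp add: dist_norm add.assoc)
    then show ?thesis using r 1 by auto
  qed
  define \<Delta> where "\<Delta> h = f (z + h *\<^sub>R a + h *\<^sub>R b) - f (z + h *\<^sub>R a) - f (z + h *\<^sub>R b) + f z" for h
  text \<open>Two applications of the mean value theorem to the second difference, in either order.\<close>
  have mvt: "\<exists>x. norm (x - z) \<le> h * (norm a + norm b) \<and> x \<in> S \<and> \<Delta> h = h * h * D2 u w x"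
    if h: "0 < h" "h < \<delta>" and uw: "(u,w) = (a,b) \<or> (u,w) = (b,a)" for h u w
  proof -
    define g where "g t = f (z + h *\<^sub>R u + t *\<^sub>R w) - f (z + t *\<^sub>R w)" for t
    have "\<exists>t. 0 < t \<and> t < h \<and> g h - g 0 = (h - 0) * (D w (z + h *\<^sub>R u + t *\<^sub>R w) - D w (z + t *\<^sub>R w))"
    proof (rule MVT2)
      fix t assume t: "0 \<le> t" "t \<le> h"
      show "(g has_real_derivative D w (z + h *\<^sub>R u + t *\<^sub>R w) - D w (z + t *\<^sub>R w)) (at t)"
        unfolding g_def[abs_def] D_def
        using inS[of h h t u w] inS[of 0 h t u w] t h uw by (intro DERIV_diff dline assms(2)) auto
    qed (use h in auto)
    then obtain t where t: "0 < t" "t < h"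
      and gt: "g h - g 0 = h * (D w (z + h *\<^sub>R u + t *\<^sub>R w) - D w (z + t *\<^sub>R w))" by auto
    have "\<exists>s. 0 < s \<and> s < h \<and> D w ((z + t *\<^sub>R w) + h *\<^sub>R u) - D w ((z + t *\<^sub>R w) + 0 *\<^sub>R u)
        = (h - 0) * D2 u w ((z + t *\<^sub>R w) + s *\<^sub>R u)"
    proof (rule MVT2)
      fix s assume s: "0 \<le> s" "s \<le> h"
      show "((\<lambda>s. D w (z + t *\<^sub>R w + s *\<^sub>R u)) has_real_derivative D2 u w (z + t *\<^sub>R w + s *\<^sub>R u)) (at s)"
        unfolding D2_def
        using inS[of t h s w u] s t h uw by (intro dline smD) auto
    qed (use h in auto)
    then obtain s where s: "0 < s" "s < h"
      and gs: "D w (z + t *\<^sub>R w + h *\<^sub>R u) - D w (z + t *\<^sub>R w) = h * D2 u w (z + t *\<^sub>R w + s *\<^sub>R u)"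
      by auto
    have "g h - g 0 = \<Delta> h" using uw by (auto simp: g_def \<Delta>_def algebra_simps)
    then have "\<Delta> h = h * h * D2 u w (z + t *\<^sub>R w + s *\<^sub>R u)"
      using gt gs by (simp add: algebra_simps)
    moreover have "z + t *\<^sub>R w + s *\<^sub>R u \<in> S \<and> norm (t *\<^sub>R w + s *\<^sub>R u) \<le> h * (norm a + norm b)"
      using inS[of t h s w u] s t h uw by auto
    ultimately show ?thesis
      by (intro exI[of _ "z + t *\<^sub>R w + s *\<^sub>R u"]) (auto simp: add.assoc)
  qed
  have "\<bar>D2 a b z - D2 b a z\<bar> \<le> e" if e: "e > 0" for e
  proof -
    have "isCont (D2 a b) z" "isCont (D2 b a) z"
      using cont assms continuous_on_eq_continuous_at by blast+
    then obtain d1 d2 where d: "d1 > 0" "d2 > 0"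
      "\<And>x. norm (x - z) < d1 \<Longrightarrow> \<bar>D2 a b x - D2 a b z\<bar> < e / 2"
      "\<And>x. norm (x - z) < d2 \<Longrightarrow> \<bar>D2 b a x - D2 b a z\<bar> < e / 2"
      using e unfolding continuous_at_eps_delta by (metis half_gt_zero dist_norm real_norm_def)
    \<comment> \<open>Small enough for the parallelogram to lie in S and for both mean value points
      to come within d1 and d2 of z.\<close>
    define h where "h = min (\<delta> / 2) (min d1 d2 / (norm a + norm b + 1) / 2)"
    have pos: "norm a + norm b + 1 > 0" by (simp add: add_nonneg_pos)
    have h: "0 < h" "h < \<delta>" using \<delta> d pos by (auto simp: h_def)
    have "h * (norm a + norm b) < h * (norm a + norm b + 1)" using h by simp
    also have "\<dots> \<le> (min d1 d2 / (norm a + norm b + 1) / 2) * (norm a + norm b + 1)"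
      unfolding h_def using pos by (intro mult_right_mono) auto
    also have "\<dots> = min d1 d2 / 2"
    proof -
      have "m / q / 2 * q = m / 2" if "q > 0" for m q :: real using that by simp
      from this[OF pos] show ?thesis .
    qed
    also have "\<dots> < min d1 d2" using d by auto
    finally have hd: "h * (norm a + norm b) < d1" "h * (norm a + norm b) < d2" by auto
    obtain x where x: "norm (x - z) \<le> h * (norm a + norm b)" "\<Delta> h = h * h * D2 a b x"
      using mvt[OF h] by blast
    obtain y where y: "norm (y - z) \<le> h * (norm a + norm b)" "\<Delta> h = h * h * D2 b a y"
      using mvt[OF h] by blast
    have "D2 a b x = D2 b a y" using x y h by auto
    then show ?thesis using d(3)[of x] d(4)[of y] x y hd by linarith
  qed
  then have "D2 a b z = D2 b a z" using field_le_epsilon[of "\<bar>D2 a b z - D2 b a z\<bar>" 0] by simp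
  then show ?thesis by (simp add: D2_def D_def[abs_def])
qed

section \<open>Curvature of projectively related sprays in a chart\<close>

lemma bounded_linear_y: "bounded_linear (\<lambda>z::'a::real_normed_vector \<times> (real^'n). snd z $ j)"
  using bounded_linear_compose[OF bounded_linear_vec_nth bounded_linear_snd] .

lemma frechet_const: "frechet_derivative (\<lambda>z. c) (at z) v = 0"
  by (simp add: frechet_eqI[OF has_derivative_const])

lemma frechet_y: "frechet_derivative (\<lambda>z::(real^'n) \<times> (real^'n). snd z $ j) (at z) v = snd v $ j"
  by (simp add: frechet_eqI[OF bounded_linear_imp_has_derivative[OF bounded_linear_y]])

lemma dx_y [simp]: "dx k (\<lambda>z. snd z $ j) z = 0"
  by (simp add: dx_def frechet_y)

lemma dy_y [simp]: "dy k (\<lambda>z. snd z $ j) z = (if j = k then 1 else 0)"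
  by (simp add: dy_def frechet_y axis_def)

lemma dx_const [simp]: "dx k (\<lambda>z. c) z = 0"
  by (simp add: dx_def frechet_const)

lemma dy_const [simp]: "dy k (\<lambda>z. c) z = 0"
  by (simp add: dy_def frechet_const)

text \<open>\<open>U\<close> stands for the chart image \<open>slit_image M c\<close>; keeping it
  abstract separates the tensor calculus from the manifold.\<close>

locale slit_calculus =
  fixes U :: "((real^'n) \<times> (real^'n)) set"
  assumes open_U: "open U"
begin

abbreviation "sm \<equiv> smooth_on U :: ((real^'n) \<times> (real^'n) \<Rightarrow> real) \<Rightarrow> bool"

lemma dx_frechet: "dx k f = (\<lambda>z. frechet_derivative f (at z) (axis k 1, 0))"
  by (simp add: dx_def fun_eq_iff)

lemma dy_frechet: "dy k f = (\<lambda>z. frechet_derivative f (at z) (0, axis k 1))"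
  by (simp add: dy_def fun_eq_iff)

lemma sm_dx [simp]: "sm f \<Longrightarrow> sm (dx k f)"
  unfolding dx_frechet by (rule smooth_on_derivative)

lemma sm_dy [simp]: "sm f \<Longrightarrow> sm (dy k f)"
  unfolding dy_frechet by (rule smooth_on_derivative)

lemma sm_const [simp]: "sm (\<lambda>z. c)"
  by (rule smooth_on_const[OF open_U])

lemma sm_y [simp]: "sm (\<lambda>z. snd z $ j)"
  by (rule smooth_on_bounded_linear[OF bounded_linear_y open_U])

lemmas sm_ops [simp] = smooth_on_add[OF open_U] smooth_on_diff[OF open_U] smooth_on_mult[OF open_U]
  smooth_on_sum[OF open_U]

lemma frechet_ops:
  fixes f g :: "(real^'n) \<times> (real^'n) \<Rightarrow> real"
  assumes "sm f" "sm g" "z \<in> U"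
  shows "frechet_derivative (\<lambda>z. f z + g z) (at z) v = frechet_derivative f (at z) v + frechet_derivative g (at z) v"
    and "frechet_derivative (\<lambda>z. f z - g z) (at z) v = frechet_derivative f (at z) v - frechet_derivative g (at z) v"
    and "frechet_derivative (\<lambda>z. f z * g z) (at z) v = frechet_derivative f (at z) v * g z + f z * frechet_derivative g (at z) v"
proof -
  note * = smooth_on_has_derivative[OF assms(1,3)] smooth_on_has_derivative[OF assms(2,3)]
  show "frechet_derivative (\<lambda>z. f z + g z) (at z) v = frechet_derivative f (at z) v + frechet_derivative g (at z) v"
    by (simp add: frechet_eqI[OF has_derivative_add[OF *]])
  show "frechet_derivative (\<lambda>z. f z - g z) (at z) v = frechet_derivative f (at z) v - frechet_derivative g (at z) v"
    by (simp add: frechet_eqI[OF has_derivative_diff[OF *]])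
  show "frechet_derivative (\<lambda>z. f z * g z) (at z) v = frechet_derivative f (at z) v * g z + f z * frechet_derivative g (at z) v"
    by (simp add: frechet_eqI[OF has_derivative_mult[OF *]])
qed

lemma frechet_sum:
  fixes f :: "'i \<Rightarrow> (real^'n) \<times> (real^'n) \<Rightarrow> real"
  assumes "\<And>i. sm (f i)" "z \<in> U"
  shows "frechet_derivative (\<lambda>z. \<Sum>i\<in>I. f i z) (at z) v = (\<Sum>i\<in>I. frechet_derivative (f i) (at z) v)"
  by (simp add: frechet_eqI[OF has_derivative_sum[OF smooth_on_has_derivative[OF assms]]])

text \<open>Specialised to the coordinate directions and folded, the rules let the simplifier
  differentiate polynomial expressions; \<open>sm_ops\<close>, \<open>sm_dx\<close> and
  \<open>sm_dy\<close> discharge their smoothness premises.\<close>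

lemmas dx_ops [simp] = frechet_ops[where v = "(axis k 1, 0)" for k, folded dx_def]
  frechet_sum[where v = "(axis k 1, 0)" for k, folded dx_def]

lemmas dy_ops [simp] = frechet_ops[where v = "(0, axis k 1)" for k, folded dy_def]
  frechet_sum[where v = "(0, axis k 1)" for k, folded dy_def]

lemma dx_cong: "(\<And>z. z \<in> U \<Longrightarrow> f z = g z) \<Longrightarrow> z \<in> U \<Longrightarrow> dx k f z = dx k g z"
  unfolding dx_def using frechet_cong[OF open_U] by metis

lemma dy_cong: "(\<And>z. z \<in> U \<Longrightarrow> f z = g z) \<Longrightarrow> z \<in> U \<Longrightarrow> dy k f z = dy k g z"
  unfolding dy_def using frechet_cong[OF open_U] by metis

lemma dx_commute: "sm f \<Longrightarrow> z \<in> U \<Longrightarrow> dx j (dx k f) z = dx k (dx j f) z"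
  unfolding dx_frechet by (rule frechet_commute[OF open_U])

lemma dy_commute: "sm f \<Longrightarrow> z \<in> U \<Longrightarrow> dy j (dy k f) z = dy k (dy j f) z"
  unfolding dy_frechet by (rule frechet_commute[OF open_U])

lemma dy_dx: "sm f \<Longrightarrow> z \<in> U \<Longrightarrow> dy j (dx k f) z = dx k (dy j f) z"
  unfolding dx_frechet dy_frechet by (rule frechet_commute[OF open_U])

text \<open>Homogeneity in \<open>y\<close> is encoded by Euler's identity, which is stable under \<open>dx\<close> and \<open>dy\<close>.\<close>

definition homogeneous :: "real \<Rightarrow> ((real^'n) \<times> (real^'n) \<Rightarrow> real) \<Rightarrow> bool" where
  "homogeneous r f \<longleftrightarrow> sm f \<and> (\<forall>z\<in>U. (\<Sum>k\<in>UNIV. snd z $ k * dy k f z) = r * f z)"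

lemma homogeneous_sm: "homogeneous r f \<Longrightarrow> sm f"
  by (simp add: homogeneous_def)

lemma euler: "homogeneous r f \<Longrightarrow> z \<in> U \<Longrightarrow> (\<Sum>k\<in>UNIV. snd z $ k * dy k f z) = r * f z"
  by (simp add: homogeneous_def)

lemma homogeneous_cong:
  assumes "\<And>z. z \<in> U \<Longrightarrow> f z = g z"
  shows "homogeneous r f \<longleftrightarrow> homogeneous r g"
  using smooth_on_cong[OF open_U, of f g] dy_cong[of f g] assms
  unfolding homogeneous_def by (auto simp: cong: sum.cong)

lemma homogeneous_y: "homogeneous 1 (\<lambda>z. snd z $ j)"
  by (simp add: homogeneous_def if_distrib cong: if_cong)

lemma homogeneous_add: "homogeneous r f \<Longrightarrow> homogeneous r g \<Longrightarrow> homogeneous r (\<lambda>z. f z + g z)"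
  by (simp add: homogeneous_def distrib_left sum.distrib)

lemma homogeneous_diff: "homogeneous r f \<Longrightarrow> homogeneous r g \<Longrightarrow> homogeneous r (\<lambda>z. f z - g z)"
  by (simp add: homogeneous_def right_diff_distrib sum_subtractf)

lemma homogeneous_mult:
  assumes "homogeneous r f" "homogeneous s g"
  shows "homogeneous (r + s) (\<lambda>z. f z * g z)"
proof -
  have "(\<Sum>k\<in>UNIV. snd z $ k * dy k (\<lambda>z. f z * g z) z) = (r + s) * (f z * g z)" if "z \<in> U" for z
  proof -
    have "(\<Sum>k\<in>UNIV. snd z $ k * dy k (\<lambda>z. f z * g z) z)
        = (\<Sum>k\<in>UNIV. snd z $ k * dy k f z) * g z + f z * (\<Sum>k\<in>UNIV. snd z $ k * dy k g z)"
      using assms that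
      by (simp add: homogeneous_sm sum_distrib_left sum_distrib_right sum.distrib[symmetric] algebra_simps)
    then show ?thesis using euler[OF assms(1) that] euler[OF assms(2) that]
      by (simp only:) (simp add: algebra_simps)
  qed
  then show ?thesis using assms by (simp add: homogeneous_def)
qed

lemma homogeneous_const: "homogeneous 0 (\<lambda>z. c)"
  by (simp add: homogeneous_def)

lemma homogeneous_cmult: "homogeneous r f \<Longrightarrow> homogeneous r (\<lambda>z. c * f z)"
  using homogeneous_mult[OF homogeneous_const] by fastforce

lemma homogeneous_sum:
  assumes "\<And>i. homogeneous r (f i)"
  shows "homogeneous r (\<lambda>z. \<Sum>i\<in>I. f i z)"
proof -
  have "(\<Sum>k\<in>UNIV. snd z $ k * dy k (\<lambda>z. \<Sum>i\<in>I. f i z) z) = r * (\<Sum>i\<in>I. f i z)" if "z \<in> U" for z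
  proof -
    have "(\<Sum>k\<in>UNIV. snd z $ k * dy k (\<lambda>z. \<Sum>i\<in>I. f i z) z) = (\<Sum>k\<in>UNIV. \<Sum>i\<in>I. snd z $ k * dy k (f i) z)"
      using homogeneous_sm[OF assms] that by (simp add: sum_distrib_left)
    also have "\<dots> = (\<Sum>i\<in>I. \<Sum>k\<in>UNIV. snd z $ k * dy k (f i) z)"
      by (rule sum.swap)
    finally show ?thesis using euler[OF assms that] by (simp add: sum_distrib_left)
  qed
  then show ?thesis using assms by (simp add: homogeneous_def)
qed

lemma homogeneous_dx:
  assumes "homogeneous r f" shows "homogeneous r (dx j f)"
proof -
  have "(\<Sum>k\<in>UNIV. snd z $ k * dy k (dx j f) z) = r * dx j f z" if z: "z \<in> U" for z
  proof -
    have "dx j (\<lambda>z. \<Sum>k\<in>UNIV. snd z $ k * dy k f z) z = dx j (\<lambda>z. r * f z) z"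
      by (rule dx_cong[OF euler[OF assms] z])
    then show ?thesis using assms z by (simp add: homogeneous_sm dy_dx)
  qed
  then show ?thesis using assms by (simp add: homogeneous_def)
qed

text \<open>Differentiating Euler's identity by y^j also hits the factor y^k; the extra term
  \<partial>f/\<partial>y^j lowers the degree by one.\<close>

lemma homogeneous_dy:
  assumes "homogeneous r f" shows "homogeneous (r - 1) (dy j f)"
proof -
  have "(\<Sum>k\<in>UNIV. snd z $ k * dy k (dy j f) z) = (r - 1) * dy j f z" if z: "z \<in> U" for z
  proof -
    have sm: "sm f" using assms homogeneous_sm by blast
    have "r * dy j f z = dy j (\<lambda>z. \<Sum>k\<in>UNIV. snd z $ k * dy k f z) z"
    proof -
      have "dy j (\<lambda>z. \<Sum>k\<in>UNIV. snd z $ k * dy k f z) z = dy j (\<lambda>z. r * f z) z"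
        by (rule dy_cong[OF euler[OF assms] z])
      then show ?thesis using sm z by simp
    qed
    also have "\<dots> = (\<Sum>k\<in>UNIV. (if k = j then dy k f z else 0) + snd z $ k * dy k (dy j f) z)"
      using sm z by (simp add: dy_commute[of f z j] if_distrib[of "\<lambda>x. x * _"] cong: if_cong)
    also have "\<dots> = dy j f z + (\<Sum>k\<in>UNIV. snd z $ k * dy k (dy j f) z)"
      by (simp add: sum.distrib)
    finally show ?thesis by (simp add: left_diff_distrib)
  qed
  then show ?thesis using assms by (simp add: homogeneous_def)
qed

section \<open>Berwald's formula for the Riemann curvature\<close>

definition berwald_R :: "((real^'n) \<times> (real^'n) \<Rightarrow> real^'n) \<Rightarrow> 'n \<Rightarrow> 'n \<Rightarrow> (real^'n) \<times> (real^'n) \<Rightarrow> real" where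
  "berwald_R H i k z = 2 * dx k (\<lambda>z. H z $ i) z
     - (\<Sum>j\<in>UNIV. snd z $ j * dx j (dy k (\<lambda>z. H z $ i)) z)
     + 2 * (\<Sum>j\<in>UNIV. H z $ j * dy j (dy k (\<lambda>z. H z $ i)) z)
     - (\<Sum>j\<in>UNIV. dy j (\<lambda>z. H z $ i) z * dy k (\<lambda>z. H z $ j) z)"

text \<open>Contraction with y^j y^l brings in Euler's identity for G, N and \<Gamma>, of degrees 2,
  1 and 0: y^j \<Gamma>^i_jk = N^i_k, y^j N^i_j = 2 G^i, and the third y-derivatives of G drop
  out.\<close>

lemma riemann2_eq_berwald_R:
  assumes H: "\<And>i. homogeneous 2 (\<lambda>z. H z $ i)" and z: "z \<in> U"
  shows "riemann2 H i k z = berwald_R H i k z"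
proof -
  define y where "y j = snd z $ j" for j
  define N where "N i j = spray_N H i j z" for i j
  define \<Gamma> where "\<Gamma> i j k = spray_Gamma H i j k z" for i j k
  define X where "X k i j l = dx k (spray_Gamma H i j l) z" for k i j l
  define Y where "Y m i j l = dy m (spray_Gamma H i j l) z" for m i j l
  have hN: "homogeneous 1 (dy j (\<lambda>z. H z $ i))" for i j
    using homogeneous_dy[OF H[of i], of j] by simp
  have h\<Gamma>: "homogeneous 0 (dy k (dy j (\<lambda>z. H z $ i)))" for i j k
    using homogeneous_dy[OF hN[of j i], of k] by simp
  have sm: "sm (\<lambda>z. H z $ i)" for i using H homogeneous_sm by blast
  have \<Gamma>sym: "\<Gamma> i j k = \<Gamma> i k j" for i j k
    unfolding \<Gamma>_def spray_Gamma_def by (rule dy_commute[OF sm z])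
  have yN: "(\<Sum>j\<in>UNIV. y j * N i j) = 2 * H z $ i" for i
    using euler[OF H z, of i] by (simp add: y_def N_def spray_N_def)
  have y\<Gamma>: "(\<Sum>j\<in>UNIV. y j * \<Gamma> i j k) = N i k" for i k
    using euler[OF hN z, of k i] by (simp add: y_def N_def spray_N_def \<Gamma>_def spray_Gamma_def)
  have yY: "(\<Sum>j\<in>UNIV. y j * Y m i j l) = 0" for m i l
  proof -
    have "Y m i j l = dy j (dy m (dy l (\<lambda>z. H z $ i))) z" for j
      unfolding Y_def spray_Gamma_def by (rule dy_commute[OF _ z]) (simp add: sm)
    then show ?thesis using euler[OF h\<Gamma> z, of m l i] by (simp add: y_def)
  qed
  have yX: "(\<Sum>j\<in>UNIV. y j * X k i j l) = dx k (dy l (\<lambda>z. H z $ i)) z" for k i l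
  proof -
    have "X k i j l = dy j (dx k (dy l (\<lambda>z. H z $ i))) z" for j
      unfolding X_def spray_Gamma_def by (rule dy_dx[symmetric, OF _ z]) (simp add: sm)
    then show ?thesis using euler[OF homogeneous_dx[OF hN] z, of k l i] by (simp add: y_def)
  qed
  have yX': "(\<Sum>l\<in>UNIV. y l * dx k (dy l (\<lambda>z. H z $ i)) z) = 2 * dx k (\<lambda>z. H z $ i) z"
    using euler[OF homogeneous_dx[OF H] z, of k i] by (simp add: y_def dy_dx[OF sm z])
  have "riemann2 H i k z = (\<Sum>j\<in>UNIV. \<Sum>l\<in>UNIV. y j * (X k i j l - (\<Sum>m\<in>UNIV. N m k * Y m i j l)
      - (X l i j k - (\<Sum>m\<in>UNIV. N m l * Y m i j k))
      + (\<Sum>s\<in>UNIV. \<Gamma> i k s * \<Gamma> s j l) - (\<Sum>s\<in>UNIV. \<Gamma> s j k * \<Gamma> i l s)) * y l)"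
    by (simp add: riemann2_def riemann4_def spray_delta_def X_def Y_def N_def \<Gamma>_def y_def)
  \<comment> \<open>Every y is moved next to the factor that it contracts, so that the Euler
    identities above can serve as rewrite rules.\<close>
  also have "\<dots> = (\<Sum>l\<in>UNIV. y l * (\<Sum>j\<in>UNIV. y j * X k i j l))
      - (\<Sum>l\<in>UNIV. y l * (\<Sum>m\<in>UNIV. N m k * (\<Sum>j\<in>UNIV. y j * Y m i j l)))
      - (\<Sum>l\<in>UNIV. y l * (\<Sum>j\<in>UNIV. y j * X l i j k))
      + (\<Sum>l\<in>UNIV. y l * (\<Sum>m\<in>UNIV. N m l * (\<Sum>j\<in>UNIV. y j * Y m i j k)))
      + (\<Sum>s\<in>UNIV. \<Gamma> i k s * (\<Sum>l\<in>UNIV. y l * (\<Sum>j\<in>UNIV. y j * \<Gamma> s j l)))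
      - (\<Sum>s\<in>UNIV. (\<Sum>j\<in>UNIV. y j * \<Gamma> s j k) * (\<Sum>l\<in>UNIV. y l * \<Gamma> i l s))"
  proof -
    have 1: "(\<Sum>j\<in>UNIV. \<Sum>l\<in>UNIV. y j * f j l * y l) = (\<Sum>l\<in>UNIV. y l * (\<Sum>j\<in>UNIV. y j * f j l))" for f
      by (subst sum.swap) (simp add: sum_distrib_left algebra_simps)
    \<comment> \<open>Interchange of summations; \<open>3\<close>, \<open>5\<close> and
      \<open>7\<close> restate it for the particular shapes that occur.\<close>
    have 2: "(\<Sum>j\<in>UNIV. y j * (\<Sum>m\<in>UNIV. c m * d m j)) = (\<Sum>m\<in>UNIV. c m * (\<Sum>j\<in>UNIV. y j * d m j))" for c :: "'n \<Rightarrow> real" and d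
      by (simp only: sum_distrib_left, subst sum.swap) (simp add: algebra_simps)
    have 3: "(\<Sum>l\<in>UNIV. y l * (\<Sum>s\<in>UNIV. N s k * \<Gamma> i l s))
      = (\<Sum>s\<in>UNIV. N s k * (\<Sum>l\<in>UNIV. y l * \<Gamma> i l s))"
      by (rule 2)
    have 4: "(\<Sum>j\<in>UNIV. y j * (\<Sum>s\<in>UNIV. \<Gamma> s j k * \<Gamma> i l s)) = (\<Sum>s\<in>UNIV. N s k * \<Gamma> i l s)" for l
      using 2[of "\<lambda>s. \<Gamma> i l s" "\<lambda>s j. \<Gamma> s j k"] by (simp add: mult.commute y\<Gamma>)
    have 5: "(\<Sum>j\<in>UNIV. y j * (\<Sum>m\<in>UNIV. N m a * Y m i j b)) = (\<Sum>m\<in>UNIV. N m a * (\<Sum>j\<in>UNIV. y j * Y m i j b))" for a b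
      by (rule 2)
    have 6: "(\<Sum>j\<in>UNIV. y j * (\<Sum>s\<in>UNIV. \<Gamma> i k s * \<Gamma> s j l)) = (\<Sum>s\<in>UNIV. \<Gamma> i k s * N s l)" for l
      unfolding 2 y\<Gamma> ..
    have 7: "(\<Sum>l\<in>UNIV. y l * (\<Sum>s\<in>UNIV. \<Gamma> i k s * N s l)) = (\<Sum>s\<in>UNIV. \<Gamma> i k s * (\<Sum>l\<in>UNIV. y l * N s l))"
      by (rule 2)
    show ?thesis
      unfolding 1 unfolding distrib_left right_diff_distrib sum.distrib sum_subtractf 4 5 6 y\<Gamma> 3 7
      by (simp add: y\<Gamma>)
  qed
  also have "\<dots> = 2 * dx k (\<lambda>z. H z $ i) z - (\<Sum>l\<in>UNIV. y l * dx l (dy k (\<lambda>z. H z $ i)) z)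
      + (\<Sum>s\<in>UNIV. \<Gamma> i k s * (2 * H z $ s)) - (\<Sum>s\<in>UNIV. N s k * N i s)"
    by (simp add: yX yY yX' y\<Gamma> yN)
  also have "(\<Sum>s\<in>UNIV. \<Gamma> i k s * (2 * H z $ s)) = 2 * (\<Sum>s\<in>UNIV. H z $ s * \<Gamma> i s k)"
    by (simp add: \<Gamma>sym[of i k] sum_distrib_left algebra_simps)
  finally show ?thesis
    by (simp add: berwald_R_def \<Gamma>_def N_def y_def spray_Gamma_def spray_N_def mult.commute)
qed

lemma homogeneous_berwald_R:
  assumes H: "\<And>i. homogeneous 2 (\<lambda>z. H z $ i)"
  shows "homogeneous 2 (berwald_R H i k)"
proof -
  have hN: "homogeneous 1 (dy j (\<lambda>z. H z $ i))" for i j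
    using homogeneous_dy[OF H[of i], of j] by simp
  have h\<Gamma>: "homogeneous 0 (dy k (dy j (\<lambda>z. H z $ i)))" for i j k
    using homogeneous_dy[OF hN[of j i], of k] by simp
  show ?thesis unfolding berwald_R_def[abs_def]
    using homogeneous_mult[OF homogeneous_y homogeneous_dx[OF hN]] homogeneous_mult[OF H h\<Gamma>]
      homogeneous_mult[OF hN hN]
    by (intro homogeneous_add homogeneous_diff homogeneous_cmult homogeneous_sum homogeneous_dx H) auto
qed

text \<open>The four terms cancel in pairs: the x-derivatives because \<partial>G^i/\<partial>x^j
  has degree two, the others because y^k \<Gamma>^i_jk = N^i_j and y^k N^j_k = 2 G^j. This identity
  later forces \<tau>_k y^k = \<rho>.\<close>

lemma berwald_R_y:
  assumes H: "\<And>i. homogeneous 2 (\<lambda>z. H z $ i)" and z: "z \<in> U"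
  shows "(\<Sum>k\<in>UNIV. berwald_R H i k z * snd z $ k) = 0"
proof -
  have hN: "homogeneous 1 (dy j (\<lambda>z. H z $ i))" for i j
    using homogeneous_dy[OF H[of i], of j] by simp
  have sm: "sm (\<lambda>z. H z $ i)" for i using H homogeneous_sm by blast
  have yX: "(\<Sum>k\<in>UNIV. snd z $ k * dx j (dy k (\<lambda>z. H z $ i)) z) = 2 * dx j (\<lambda>z. H z $ i) z" for j
    using euler[OF homogeneous_dx[OF H] z, of j i] by (simp add: dy_dx[OF sm z])
  have yT: "(\<Sum>k\<in>UNIV. snd z $ k * dy j (dy k (\<lambda>z. H z $ i)) z) = dy j (\<lambda>z. H z $ i) z" for j
    using euler[OF hN z, of j i] by (simp add: dy_commute[OF sm z, of _ j])
  have swap: "(\<Sum>k\<in>UNIV. snd z $ k * (\<Sum>j\<in>UNIV. c j * d j k)) = (\<Sum>j\<in>UNIV. c j * (\<Sum>k\<in>UNIV. snd z $ k * d j k))" for c :: "'n \<Rightarrow> real" and d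
    by (simp only: sum_distrib_left, subst sum.swap) (simp add: algebra_simps)
  have yH: "(\<Sum>j\<in>UNIV. snd z $ j * dy j (\<lambda>z. H z $ i) z) = 2 * H z $ i" for i
    using euler[OF H z] .
  have "(\<Sum>k\<in>UNIV. snd z $ k * berwald_R H i k z) =
      2 * (\<Sum>k\<in>UNIV. snd z $ k * dx k (\<lambda>z. H z $ i) z)
      - (\<Sum>k\<in>UNIV. snd z $ k * (\<Sum>j\<in>UNIV. snd z $ j * dx j (dy k (\<lambda>z. H z $ i)) z))
      + 2 * (\<Sum>k\<in>UNIV. snd z $ k * (\<Sum>j\<in>UNIV. H z $ j * dy j (dy k (\<lambda>z. H z $ i)) z))
      - (\<Sum>k\<in>UNIV. snd z $ k * (\<Sum>j\<in>UNIV. dy j (\<lambda>z. H z $ i) z * dy k (\<lambda>z. H z $ j) z))"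
    unfolding berwald_R_def distrib_left right_diff_distrib sum.distrib sum_subtractf mult.left_commute[of "snd z $ _" 2]
      sum_distrib_left[symmetric] ..
  also have "\<dots> = 2 * (\<Sum>k\<in>UNIV. snd z $ k * dx k (\<lambda>z. H z $ i) z)
      - (\<Sum>j\<in>UNIV. 2 * (snd z $ j * dx j (\<lambda>z. H z $ i) z))
      + 2 * (\<Sum>j\<in>UNIV. H z $ j * dy j (\<lambda>z. H z $ i) z)
      - (\<Sum>j\<in>UNIV. 2 * (H z $ j * dy j (\<lambda>z. H z $ i) z))"
    unfolding swap yX yT yH by (simp add: ac_simps)
  also have "\<dots> = 0"
    by (simp add: sum_distrib_left)
  finally show ?thesis by (simp add: mult.commute)
qed

text \<open>Only the shape of the change matters, hence the existential quantifiers. The terms P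
  N^i_k and P_.k G^i would spoil it; they occur with coefficient 2 both in 2 H^j H^i_.j.k and in the
  product of the first derivatives, and cancel. The witness for \<Xi> is P^2 - G(P), where G(P) =
  y^j \<partial>P/\<partial>x^j - 2 G^j P_.j is the derivative of P along the spray.\<close>

lemma berwald_R_projective:
  assumes G: "\<And>i. homogeneous 2 (\<lambda>z. G z $ i)" and P: "homogeneous 1 P"
    and H: "\<And>z i. z \<in> U \<Longrightarrow> H z $ i = G z $ i + P z * snd z $ i" and z: "z \<in> U"
  shows "\<exists>\<Xi> \<tau>. \<forall>i k. berwald_R H i k z =
    berwald_R G i k z + \<Xi> * (if i = k then 1 else 0) - \<tau> k * snd z $ i"
proof -
  have smG: "sm (\<lambda>z. G z $ i)" for i using G homogeneous_sm by blast
  have smP: "sm P" using P homogeneous_sm by blast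
  define y where "y j = snd z $ j" for j
  define g where "g j = G z $ j" for j
  define p where "p = P z"
  define \<delta> where "\<delta> i j = (if i = j then 1 else 0 :: real)" for i j :: 'n
  define N where "N i k = dy k (\<lambda>z. G z $ i) z" for i k
  define \<Gamma> where "\<Gamma> i j k = dy j (dy k (\<lambda>z. G z $ i)) z" for i j k
  define X where "X i j k = dx j (dy k (\<lambda>z. G z $ i)) z" for i j k
  define p1 where "p1 k = dy k P z" for k
  define p2 where "p2 j k = dy j (dy k P) z" for j k
  define q where "q k = dx k P z" for k
  define q2 where "q2 j k = dx j (dy k P) z" for j k
  have dxH: "dx k (\<lambda>z. H z $ i) z = dx k (\<lambda>z. G z $ i) z + q k * y i" for i k
  proof -
    have "dx k (\<lambda>z. H z $ i) z = dx k (\<lambda>z. G z $ i + P z * snd z $ i) z"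
      by (rule dx_cong[OF H z])
    then show ?thesis using smG smP z by (simp add: q_def y_def)
  qed
  have dyH: "dy k (\<lambda>z. H z $ i) w = dy k (\<lambda>z. G z $ i) w + (dy k P w * snd w $ i + P w * \<delta> i k)" if "w \<in> U" for i k w
  proof -
    have "dy k (\<lambda>z. H z $ i) w = dy k (\<lambda>z. G z $ i + P z * snd z $ i) w"
      by (rule dy_cong[OF H that])
    then show ?thesis using smG smP that by (simp add: \<delta>_def eq_commute[of k])
  qed
  have dxdyH: "dx j (dy k (\<lambda>z. H z $ i)) z = X i j k + (q2 j k * y i + q j * \<delta> i k)" for i j k
  proof -
    have "dx j (dy k (\<lambda>z. H z $ i)) z = dx j (\<lambda>w. dy k (\<lambda>z. G z $ i) w + (dy k P w * snd w $ i + P w * \<delta> i k)) z"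
      by (rule dx_cong[OF dyH z])
    then show ?thesis using smG smP z by (simp add: q_def y_def X_def q2_def)
  qed
  have dydyH: "dy j (dy k (\<lambda>z. H z $ i)) z = \<Gamma> i j k + (p2 j k * y i + p1 k * \<delta> i j + p1 j * \<delta> i k)" for i j k
  proof -
    have "dy j (dy k (\<lambda>z. H z $ i)) z = dy j (\<lambda>w. dy k (\<lambda>z. G z $ i) w + (dy k P w * snd w $ i + P w * \<delta> i k)) z"
      by (rule dy_cong[OF dyH z])
    then show ?thesis using smG smP z by (simp add: p1_def y_def \<Gamma>_def p2_def \<delta>_def)
  qed
  have hN: "homogeneous 1 (dy j (\<lambda>z. G z $ i))" for i j
    using homogeneous_dy[OF G[of i], of j] by simp
  have yp1: "(\<Sum>j\<in>UNIV. y j * p1 j) = p"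
    using euler[OF P z] by (simp add: y_def p1_def p_def)
  have yp2: "(\<Sum>j\<in>UNIV. y j * p2 j k) = 0" for k
    using euler[OF homogeneous_dy[OF P] z] by (simp add: y_def p2_def)
  have yN: "(\<Sum>j\<in>UNIV. y j * N i j) = 2 * g i" for i
    using euler[OF G z] by (simp add: y_def N_def g_def)
  have y\<Gamma>: "(\<Sum>j\<in>UNIV. y j * \<Gamma> i j k) = N i k" for i k
    using euler[OF hN z, of k i] by (simp add: y_def N_def \<Gamma>_def)
  have \<delta>: "(\<Sum>j\<in>UNIV. a j * \<delta> i j) = a i" "(\<Sum>j\<in>UNIV. a j * \<delta> j i) = a i" for a :: "'n \<Rightarrow> real" and i
    by (simp_all add: \<delta>_def if_distrib cong: if_cong)
  have s1: "(\<Sum>j\<in>UNIV. y j * (X i j k + (q2 j k * y i + q j * \<delta> i k)))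
      = (\<Sum>j\<in>UNIV. y j * X i j k) + y i * (\<Sum>j\<in>UNIV. y j * q2 j k) + \<delta> i k * (\<Sum>j\<in>UNIV. y j * q j)" for i k
    by (simp add: sum.distrib sum_distrib_left algebra_simps)
  have s2: "(\<Sum>j\<in>UNIV. (g j + p * y j) * (\<Gamma> i j k + (p2 j k * y i + p1 k * \<delta> i j + p1 j * \<delta> i k)))
      = (\<Sum>j\<in>UNIV. g j * \<Gamma> i j k) + p * N i k + y i * (\<Sum>j\<in>UNIV. g j * p2 j k)
        + p1 k * (g i + p * y i) + \<delta> i k * ((\<Sum>j\<in>UNIV. g j * p1 j) + p * p)" for i k
  proof -
    \<comment> \<open>The values p, 0 and \<open>N i k\<close> are traded back for the Euler sums
      that produce them; then both sides agree by distributivity alone. The same device proves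
      \<open>s3\<close>.\<close>
    have "?thesis \<longleftrightarrow> (\<Sum>j\<in>UNIV. (g j + p * y j) * (\<Gamma> i j k + (p2 j k * y i + p1 k * \<delta> i j + p1 j * \<delta> i k)))
      = (\<Sum>j\<in>UNIV. g j * \<Gamma> i j k) + p * (\<Sum>j\<in>UNIV. y j * \<Gamma> i j k) + y i * (\<Sum>j\<in>UNIV. g j * p2 j k)
        + p * y i * (\<Sum>j\<in>UNIV. y j * p2 j k)
        + p1 k * (\<Sum>j\<in>UNIV. (g j + p * y j) * \<delta> i j)
        + \<delta> i k * ((\<Sum>j\<in>UNIV. g j * p1 j) + p * (\<Sum>j\<in>UNIV. y j * p1 j))"
      unfolding y\<Gamma> yp2 yp1 \<delta> by simp
    moreover have "\<dots>" by (simp add: sum.distrib sum_distrib_left algebra_simps)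
    ultimately show ?thesis by blast
  qed
  have s3: "(\<Sum>j\<in>UNIV. (N i j + (p1 j * y i + p * \<delta> i j)) * (N j k + (p1 k * y j + p * \<delta> j k)))
      = (\<Sum>j\<in>UNIV. N i j * N j k) + 2 * p1 k * g i + 2 * p * N i k + y i * (\<Sum>j\<in>UNIV. p1 j * N j k)
        + 3 * p * p1 k * y i + p * p * \<delta> i k" for i k
  proof -
    have "?thesis \<longleftrightarrow> (\<Sum>j\<in>UNIV. (N i j + (p1 j * y i + p * \<delta> i j)) * (N j k + (p1 k * y j + p * \<delta> j k)))
      = (\<Sum>j\<in>UNIV. N i j * N j k) + p1 k * (\<Sum>j\<in>UNIV. y j * N i j) + p * (\<Sum>j\<in>UNIV. N i j * \<delta> j k)
        + y i * (\<Sum>j\<in>UNIV. p1 j * N j k) + p1 k * y i * (\<Sum>j\<in>UNIV. y j * p1 j) + p * y i * (\<Sum>j\<in>UNIV. p1 j * \<delta> j k)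
        + p * (\<Sum>j\<in>UNIV. (N j k + (p1 k * y j + p * \<delta> j k)) * \<delta> i j)"
      unfolding yN yp1 \<delta> by (simp add: algebra_simps)
    moreover have "\<dots>" by (simp add: sum.distrib sum_distrib_left algebra_simps)
    ultimately show ?thesis by blast
  qed
  have "berwald_R H i k z = berwald_R G i k z
      + (p * p + 2 * (\<Sum>j\<in>UNIV. g j * p1 j) - (\<Sum>j\<in>UNIV. y j * q j)) * \<delta> i k
      - ((\<Sum>j\<in>UNIV. y j * q2 j k) - 2 * q k - 2 * (\<Sum>j\<in>UNIV. g j * p2 j k) + p * p1 k + (\<Sum>j\<in>UNIV. p1 j * N j k)) * y i"
    for i k
    unfolding berwald_R_def dxH dyH[OF z] dxdyH dydyH H[OF z]
      y_def[symmetric] g_def[symmetric] p_def[symmetric] p1_def[symmetric] N_def[symmetric] \<Gamma>_def[symmetric] X_def[symmetric]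
    by (simp only: s1 s2 s3) (simp add: algebra_simps)
  then show ?thesis unfolding \<delta>_def y_def
    by (intro exI[of _ "p * p + 2 * (\<Sum>j\<in>UNIV. g j * p1 j) - (\<Sum>j\<in>UNIV. snd z $ j * q j)"]
       exI[of _ "\<lambda>k. (\<Sum>j\<in>UNIV. snd z $ j * q2 j k) - 2 * q k - 2 * (\<Sum>j\<in>UNIV. g j * p2 j k) + p * p1 k + (\<Sum>j\<in>UNIV. p1 j * N j k)"]) auto
qed

section \<open>The trace identity and isotropy\<close>

lemma homogeneous_sm_berwald_R:
  "(\<And>i. homogeneous 2 (\<lambda>z. H z $ i)) \<Longrightarrow> sm (berwald_R H i k)"
  using homogeneous_berwald_R homogeneous_sm by blast

text \<open>In the third-order terms the y-derivative by m is moved innermost, so that for m = i the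
  trace shows the divergence. The separate term with \<open>dx m\<close> stems from the factor
  y^j.\<close>

lemma dy_berwald_R:
  assumes sm: "\<And>i. sm (\<lambda>z. H z $ i)" and z: "z \<in> U"
  shows "dy m (berwald_R H i k) z = 2 * dx k (dy m (\<lambda>z. H z $ i)) z
     - (dx m (dy k (\<lambda>z. H z $ i)) z + (\<Sum>j\<in>UNIV. snd z $ j * dx j (dy k (dy m (\<lambda>z. H z $ i))) z))
     + 2 * (\<Sum>j\<in>UNIV. dy m (\<lambda>z. H z $ j) z * dy j (dy k (\<lambda>z. H z $ i)) z
          + H z $ j * dy j (dy k (dy m (\<lambda>z. H z $ i))) z)
     - (\<Sum>j\<in>UNIV. dy m (dy j (\<lambda>z. H z $ i)) z * dy k (\<lambda>z. H z $ j) z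
          + dy j (\<lambda>z. H z $ i) z * dy m (dy k (\<lambda>z. H z $ j)) z)"
proof -
  have c: "dy m (dy k (\<lambda>z. H z $ i)) w = dy k (dy m (\<lambda>z. H z $ i)) w" if "w \<in> U" for w
    by (rule dy_commute[OF sm that])
  have 1: "dy m (dx j (dy k (\<lambda>z. H z $ i))) z = dx j (dy k (dy m (\<lambda>z. H z $ i))) z" for j
    using dy_dx[of "dy k (\<lambda>z. H z $ i)" z m j] dx_cong[of "dy m (dy k (\<lambda>z. H z $ i))" "dy k (dy m (\<lambda>z. H z $ i))" z j] c sm z
    by simp
  have 2: "dy m (dy j (dy k (\<lambda>z. H z $ i))) z = dy j (dy k (dy m (\<lambda>z. H z $ i))) z" for j
    using dy_commute[of "dy k (\<lambda>z. H z $ i)" z m j] dy_cong[of "dy m (dy k (\<lambda>z. H z $ i))" "dy k (dy m (\<lambda>z. H z $ i))" z j] c sm z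
    by simp
  have 3: "dy m (dx k (\<lambda>z. H z $ i)) z = dx k (dy m (\<lambda>z. H z $ i)) z"
    by (rule dy_dx[OF sm z])
  have 4: "(\<Sum>j\<in>UNIV. (if j = m then 1 else 0) * d j) = d m" for d :: "'n \<Rightarrow> real"
    by (simp add: if_distrib[of "\<lambda>x. x * _"] cong: if_cong)
  show ?thesis unfolding berwald_R_def[abs_def] using sm z
    by (simp add: 1 2 3) (simp add: sum.distrib 4)
qed

lemma berwald_R_trace_identity:
  assumes H: "\<And>i. homogeneous 2 (\<lambda>z. H z $ i)" and z: "z \<in> U"
  defines "dvg \<equiv> \<lambda>w. \<Sum>i\<in>UNIV. dy i (\<lambda>z. H z $ i) w"
  shows "2 * (\<Sum>m\<in>UNIV. dy m (berwald_R H m k) z) + dy k (\<lambda>w. \<Sum>m\<in>UNIV. berwald_R H m m w) z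
    = 3 * dx k dvg z - 3 * (\<Sum>j\<in>UNIV. snd z $ j * dx j (dy k dvg) z) + 6 * (\<Sum>j\<in>UNIV. H z $ j * dy j (dy k dvg) z)"
proof -
  have sm: "sm (\<lambda>z. H z $ i)" for i using H homogeneous_sm by blast
  have dydiv: "dy k dvg w = (\<Sum>i\<in>UNIV. dy k (dy i (\<lambda>z. H z $ i)) w)" if "w \<in> U" for w
    unfolding dvg_def using sm that by simp
  have 1: "dx k dvg z = (\<Sum>i\<in>UNIV. dx k (dy i (\<lambda>z. H z $ i)) z)"
    unfolding dvg_def using sm z by simp
  have 2: "dx j (dy k dvg) z = (\<Sum>i\<in>UNIV. dx j (dy k (dy i (\<lambda>z. H z $ i))) z)" for j
  proof -
    have "dx j (dy k dvg) z = dx j (\<lambda>w. \<Sum>i\<in>UNIV. dy k (dy i (\<lambda>z. H z $ i)) w) z"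
      by (rule dx_cong[OF dydiv z])
    then show ?thesis using sm z by simp
  qed
  have 3: "dy j (dy k dvg) z = (\<Sum>i\<in>UNIV. dy j (dy k (dy i (\<lambda>z. H z $ i))) z)" for j
  proof -
    have "dy j (dy k dvg) z = dy j (\<lambda>w. \<Sum>i\<in>UNIV. dy k (dy i (\<lambda>z. H z $ i)) w) z"
      by (rule dy_cong[OF dydiv z])
    then show ?thesis using sm z by simp
  qed
  define X where "X a b i = dx a (dy b (\<lambda>z. H z $ i)) z" for a b i
  define N where "N i j = dy j (\<lambda>z. H z $ i) z" for i j
  define \<Gamma> where "\<Gamma> i j l = dy j (dy l (\<lambda>z. H z $ i)) z" for i j l
  define Y where "Y j a i = dx j (dy a (dy i (\<lambda>z. H z $ i))) z" for j a i
  define T where "T j a i = dy j (dy a (dy i (\<lambda>z. H z $ i))) z" for j a i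
  have Ysym: "dx j (dy i (dy k (\<lambda>z. H z $ i))) z = Y j k i" for j i
    unfolding Y_def by (rule dx_cong[OF dy_commute[OF sm] z])
  have Tsym: "dy j (dy i (dy k (\<lambda>z. H z $ i))) z = T j k i" for j i
    unfolding T_def by (rule dy_cong[OF dy_commute[OF sm] z])
  have \<Gamma>sym: "\<Gamma> i j l = \<Gamma> i l j" for i j l
    unfolding \<Gamma>_def by (rule dy_commute[OF sm z])
  \<comment> \<open>The first trace contains a - b and the second 2 b - 2 a, so these products
    cancel under the weights 2 and 1. The sum of the \<open>X m k m\<close> has coefficients -1 and
    2 and cancels as well, while c and d add up.\<close>
  define a where "a = (\<Sum>m\<in>UNIV. \<Sum>j\<in>UNIV. N m j * \<Gamma> j m k)"
  define b where "b = (\<Sum>m\<in>UNIV. \<Sum>j\<in>UNIV. \<Gamma> m m j * N j k)"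
  define c where "c = (\<Sum>m\<in>UNIV. \<Sum>j\<in>UNIV. H z $ j * T j k m)"
  define d where "d = (\<Sum>m\<in>UNIV. \<Sum>j\<in>UNIV. snd z $ j * Y j k m)"
  have "(\<Sum>m\<in>UNIV. dy m (berwald_R H m k) z) = 2 * (\<Sum>m\<in>UNIV. X k m m) - (\<Sum>m\<in>UNIV. X m k m) - d
      + 2 * (\<Sum>m\<in>UNIV. \<Sum>j\<in>UNIV. N j m * \<Gamma> m j k) + 2 * c - b - a"
    unfolding dy_berwald_R[OF sm z] a_def b_def c_def d_def X_def[symmetric] Y_def[symmetric] T_def[symmetric]
      N_def[symmetric] \<Gamma>_def[symmetric]
    by (simp add: sum.distrib sum_subtractf sum_distrib_left)
  moreover have "(\<Sum>m\<in>UNIV. \<Sum>j\<in>UNIV. N j m * \<Gamma> m j k) = a"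
    unfolding a_def by (rule sum.swap)
  moreover have "dy k (\<lambda>w. \<Sum>m\<in>UNIV. berwald_R H m m w) z = 2 * (\<Sum>m\<in>UNIV. X m k m) - (\<Sum>m\<in>UNIV. X k m m) - d
      + 2 * b + 2 * c - a - a"
  proof -
    have "dy k (\<lambda>w. \<Sum>m\<in>UNIV. berwald_R H m m w) z = (\<Sum>m\<in>UNIV. dy k (berwald_R H m m) z)"
      using homogeneous_sm_berwald_R[OF H] z by simp
    also have "\<dots> = 2 * (\<Sum>m\<in>UNIV. X m k m) - (\<Sum>m\<in>UNIV. X k m m) - d
      + 2 * (\<Sum>m\<in>UNIV. \<Sum>j\<in>UNIV. N j k * \<Gamma> m j m) + 2 * c - (\<Sum>m\<in>UNIV. \<Sum>j\<in>UNIV. \<Gamma> m k j * N j m)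
      - (\<Sum>m\<in>UNIV. \<Sum>j\<in>UNIV. N m j * \<Gamma> j k m)"
      unfolding dy_berwald_R[OF sm z] Ysym Tsym unfolding a_def b_def c_def d_def X_def[symmetric]
        N_def[symmetric] \<Gamma>_def[symmetric]
      by (simp add: sum.distrib sum_subtractf sum_distrib_left)
    also have "(\<Sum>m\<in>UNIV. \<Sum>j\<in>UNIV. N j k * \<Gamma> m j m) = b"
      unfolding b_def by (simp add: \<Gamma>sym mult.commute)
    also have "(\<Sum>m\<in>UNIV. \<Sum>j\<in>UNIV. \<Gamma> m k j * N j m) = a"
      unfolding a_def by (subst sum.swap) (simp add: \<Gamma>sym mult.commute)
    also have "(\<Sum>m\<in>UNIV. \<Sum>j\<in>UNIV. N m j * \<Gamma> j k m) = a"
      unfolding a_def by (simp add: \<Gamma>sym)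
    finally show ?thesis .
  qed
  moreover have "d = (\<Sum>j\<in>UNIV. snd z $ j * dx j (dy k dvg) z)"
    unfolding d_def 2 Y_def by (subst sum.swap) (simp add: sum_distrib_left)
  moreover have "c = (\<Sum>j\<in>UNIV. H z $ j * dy j (dy k dvg) z)"
    unfolding c_def 3 T_def by (subst sum.swap) (simp add: sum_distrib_left)
  moreover have "dx k dvg z = (\<Sum>m\<in>UNIV. X k m m)" by (simp add: 1 X_def)
  ultimately show ?thesis by simp
qed

text \<open>As f depends on x only, \<open>div\<close> makes the divergence linear in y with the
  coefficients \<partial>f/\<partial>x^m; symmetry of the second derivatives of f then annihilates
  the right-hand side of \<open>berwald_R_trace_identity\<close>.\<close>

lemma isotropic_of_closed_divergence:
  assumes H: "\<And>i. homogeneous 2 (\<lambda>z. H z $ i)"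
    and n: "CARD('n) \<ge> 2" and y0: "\<And>z. z \<in> U \<Longrightarrow> snd z \<noteq> 0"
    and scal: "\<And>z. z \<in> U \<Longrightarrow> \<exists>\<rho> \<tau>. \<forall>i k. berwald_R H i k z = \<rho> * (if i = k then 1 else 0) - \<tau> k * snd z $ i"
    and f: "sm f" "\<And>z k. z \<in> U \<Longrightarrow> dy k f z = 0"
    and div: "\<And>z. z \<in> U \<Longrightarrow> (\<Sum>i\<in>UNIV. dy i (\<lambda>z. H z $ i) z) = (\<Sum>m\<in>UNIV. snd z $ m * dx m f z)"
    and z: "z \<in> U"
  shows "riemann2 H i k z = ricci_scalar H z * (if i = k then 1 else 0) - 1 / 2 * dy k (ricci_scalar H) z * snd z $ i"
proof -
  note smR [simp] = homogeneous_sm_berwald_R[OF H]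
  define \<rho> where "\<rho> w = 1 / (real CARD('n) - 1) * (\<Sum>m\<in>UNIV. berwald_R H m m w)" for w
  have sm\<rho> [simp]: "sm \<rho>" unfolding \<rho>_def[abs_def] by (intro sm_ops sm_const smR)
  have ric: "ricci_scalar H w = \<rho> w" if "w \<in> U" for w
    using riemann2_eq_berwald_R[OF H that] by (simp add: ricci_scalar_def \<rho>_def)
  define q where "q w = (\<Sum>i\<in>UNIV. snd w $ i * snd w $ i)" for w :: "(real^'n) \<times> (real^'n)"
  have q0: "q w \<noteq> 0" if "w \<in> U" for w
    using y0[OF that] by (simp add: q_def inner_vec_def[symmetric] flip: inner_real_def)
  \<comment> \<open>The relation R^i_k = \<rho> \<delta>^i_k - \<tau>_k y^i, multiplied by y^i,
    summed over i and solved for \<tau>_k. The result is smooth because q does not vanish.\<close>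
  define \<tau> where "\<tau> k w = (\<rho> w * snd w $ k - (\<Sum>i\<in>UNIV. berwald_R H i k w * snd w $ i)) * inverse (q w)" for k w
  have "sm q" unfolding q_def[abs_def] by simp
  then have "sm (\<lambda>w. inverse (q w))" using smooth_on_inverse[OF open_U] q0 by blast
  then have sm\<tau> [simp]: "sm (\<tau> k)" for k unfolding \<tau>_def[abs_def] by simp
  have R: "berwald_R H i k w = \<rho> w * (if i = k then 1 else 0) - \<tau> k w * snd w $ i" if w: "w \<in> U" for w i k
  proof -
    obtain r t where rt: "\<And>i k. berwald_R H i k w = r * (if i = k then 1 else 0) - t k * snd w $ i"
      using scal[OF w] by blast
    obtain i0 where i0: "snd w $ i0 \<noteq> 0" using y0[OF w] by (metis vec_eq_iff zero_index)
    \<comment> \<open>R^i_k y^k = 0 reads (r - t_k y^k) y^i = 0, and some component of y is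
      nonzero.\<close>
    have s: "(\<Sum>k\<in>UNIV. t k * snd w $ k) = r"
    proof -
      have "0 = (\<Sum>k\<in>UNIV. berwald_R H i0 k w * snd w $ k)" using berwald_R_y[OF H w] by simp
      also have "\<dots> = (\<Sum>k\<in>UNIV. (if i0 = k then r * snd w $ k else 0) - snd w $ i0 * (t k * snd w $ k))"
        unfolding rt by (intro sum.cong) (auto simp: algebra_simps)
      also have "\<dots> = r * snd w $ i0 - snd w $ i0 * (\<Sum>k\<in>UNIV. t k * snd w $ k)"
        by (simp add: sum_subtractf sum_distrib_left)
      finally show ?thesis using i0 by simp
    qed
    \<comment> \<open>The trace is n r - t_m y^m; since n is at least 2, the factor n - 1 can be
      divided out.\<close>
    have "(\<Sum>m\<in>UNIV. berwald_R H m m w) = (real CARD('n) - 1) * r"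
      unfolding rt by (simp add: sum_subtractf s algebra_simps)
    then have "\<rho> w = r" using n by (simp add: \<rho>_def)
    moreover have "\<tau> k w = t k" for k
    proof -
      have "(\<Sum>i\<in>UNIV. berwald_R H i k w * snd w $ i) = (\<Sum>i\<in>UNIV. (if k = i then r * snd w $ i else 0) - t k * (snd w $ i * snd w $ i))"
        unfolding rt by (intro sum.cong) (auto simp: algebra_simps)
      also have "\<dots> = r * snd w $ k - t k * q w"
        by (simp add: sum_subtractf sum_distrib_left q_def)
      finally show ?thesis using q0[OF w] \<open>\<rho> w = r\<close> by (simp add: \<tau>_def)
    qed
    ultimately show ?thesis using rt by simp
  qed
  have dyR: "dy j (berwald_R H i k) z = dy j \<rho> z * (if i = k then 1 else 0)
      - (dy j (\<tau> k) z * snd z $ i + \<tau> k z * (if i = j then 1 else 0))" for i j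
  proof -
    have "dy j (berwald_R H i k) z = dy j (\<lambda>w. \<rho> w * (if i = k then 1 else 0) - \<tau> k w * snd w $ i) z"
      by (rule dy_cong[OF R z])
    then show ?thesis using z by simp
  qed
  have e\<rho>: "(\<Sum>j\<in>UNIV. snd z $ j * dy j \<rho> z) = 2 * \<rho> z"
  proof -
    have "homogeneous 2 \<rho>" unfolding \<rho>_def[abs_def]
      by (intro homogeneous_cmult homogeneous_sum homogeneous_berwald_R H)
    then show ?thesis using euler z by blast
  qed
  define e where "e = (\<Sum>j\<in>UNIV. snd z $ j * dy j (\<tau> k) z)"
  \<comment> \<open>Euler's identity for \<tau>_k is read off from that of R^i_k at an index where y
    does not vanish.\<close>
  have e: "e = \<tau> k z"
  proof -
    obtain i0 where i0: "snd z $ i0 \<noteq> 0" using y0[OF z] by (metis vec_eq_iff zero_index)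
    define \<delta> where "\<delta> = (if i0 = k then 1 else 0 :: real)"
    have "2 * (\<rho> z * \<delta> - \<tau> k z * snd z $ i0) = (\<Sum>j\<in>UNIV. snd z $ j * dy j (berwald_R H i0 k) z)"
      using euler[OF homogeneous_berwald_R[OF H] z] R[OF z] by (simp add: \<delta>_def)
    also have "\<dots> = (\<Sum>j\<in>UNIV. snd z $ j * dy j \<rho> z * \<delta> - snd z $ j * dy j (\<tau> k) z * snd z $ i0
        - (if i0 = j then \<tau> k z * snd z $ j else 0))"
      unfolding dyR \<delta>_def[symmetric] by (intro sum.cong) (auto simp: algebra_simps)
    also have "\<dots> = 2 * \<rho> z * \<delta> - e * snd z $ i0 - \<tau> k z * snd z $ i0"
      by (simp add: sum_subtractf e_def flip: sum_distrib_right e\<rho>)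
    finally show ?thesis using i0 by (simp add: algebra_simps)
  qed
  \<comment> \<open>In n + 1, the n comes from \<partial>y^m/\<partial>y^m and the 1 from Euler's
    identity for \<tau>_k.\<close>
  have 1: "(\<Sum>m\<in>UNIV. dy m (berwald_R H m k) z) = dy k \<rho> z - (real CARD('n) + 1) * \<tau> k z"
  proof -
    have "(\<Sum>m\<in>UNIV. dy m (berwald_R H m k) z) =
        (\<Sum>m\<in>UNIV. (if k = m then dy m \<rho> z else 0) - (snd z $ m * dy m (\<tau> k) z + \<tau> k z))"
      unfolding dyR by (intro sum.cong) (auto simp: algebra_simps)
    also have "\<dots> = dy k \<rho> z - (e + real CARD('n) * \<tau> k z)"
      by (simp add: sum_subtractf sum.distrib e_def)
    finally show ?thesis by (simp add: e algebra_simps)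
  qed
  have 2: "dy k (\<lambda>w. \<Sum>m\<in>UNIV. berwald_R H m m w) z = (real CARD('n) - 1) * dy k \<rho> z"
  proof -
    have "(\<lambda>w. \<Sum>m\<in>UNIV. berwald_R H m m w) = (\<lambda>w. (real CARD('n) - 1) * \<rho> w)"
      using n by (simp add: \<rho>_def)
    then show ?thesis using z by simp
  qed
  let ?dvg = "\<lambda>w. \<Sum>i\<in>UNIV. dy i (\<lambda>z. H z $ i) w"
  have dy_dxf: "dy j (dx m f) w = 0" if "w \<in> U" for j m w
  proof -
    have "dx m (dy j f) w = dx m (\<lambda>_. 0) w" by (rule dx_cong[OF f(2) that])
    then show ?thesis using dy_dx[OF f(1) that, of j m] by simp
  qed
  have dydiv: "dy l ?dvg w = dx l f w" if w: "w \<in> U" for l w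
  proof -
    have "dy l ?dvg w = dy l (\<lambda>w. \<Sum>m\<in>UNIV. snd w $ m * dx m f w) w"
      by (rule dy_cong[OF div w])
    also have "\<dots> = (\<Sum>m\<in>UNIV. (if m = l then 1 else 0) * dx m f w)"
      using w f(1) dy_dxf[OF w] by simp
    also have "\<dots> = dx l f w"
      by (simp add: if_distrib[of "\<lambda>x. x * _"] cong: if_cong)
    finally show ?thesis .
  qed
  have a: "dx k ?dvg z = (\<Sum>j\<in>UNIV. snd z $ j * dx k (dx j f) z)"
  proof -
    have "dx k ?dvg z = dx k (\<lambda>w. \<Sum>m\<in>UNIV. snd w $ m * dx m f w) z"
      by (rule dx_cong[OF div z])
    then show ?thesis using z f(1) by simp
  qed
  have b: "dx j (dy k ?dvg) z = dx k (dx j f) z" for j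
  proof -
    have "dx j (dy k ?dvg) z = dx j (dx k f) z" by (rule dx_cong[OF dydiv z])
    then show ?thesis using dx_commute[OF f(1) z] by simp
  qed
  have c: "dy j (dy k ?dvg) z = 0" for j
  proof -
    have "dy j (dy k ?dvg) z = dy j (dx k f) z" by (rule dy_cong[OF dydiv z])
    then show ?thesis using dy_dxf[OF z] by simp
  qed
  \<comment> \<open>By \<open>a\<close>, \<open>b\<close> and \<open>c\<close> the first two terms
    on the right of the trace identity cancel and the third vanishes.\<close>
  have "2 * (dy k \<rho> z - (real CARD('n) + 1) * \<tau> k z) + (real CARD('n) - 1) * dy k \<rho> z = 0"
    using berwald_R_trace_identity[OF H z, of k] unfolding 1 2 a b c by simp
  then have "(real CARD('n) + 1) * (dy k \<rho> z - 2 * \<tau> k z) = 0" by (simp add: algebra_simps)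
  then have "\<tau> k z = 1 / 2 * dy k \<rho> z" by (simp add: add_nonneg_eq_0_iff)
  moreover have "dy k (ricci_scalar H) z = dy k \<rho> z" by (rule dy_cong[OF ric z])
  ultimately show ?thesis using R[OF z] ric[OF z] riemann2_eq_berwald_R[OF H z] by simp
qed

lemma isotropic_of_projective_change:
  assumes G: "\<And>i. homogeneous 2 (\<lambda>z. G z $ i)"
    and n: "CARD('n) \<ge> 2" and y0: "\<And>z. z \<in> U \<Longrightarrow> snd z \<noteq> 0"
    and scal: "\<And>z. z \<in> U \<Longrightarrow> \<exists>\<tau>. \<forall>i k. riemann2 G i k z = ricci_scalar G z * (if i = k then 1 else 0) - \<tau> k * snd z $ i"
    and f: "sm f" "\<And>z k. z \<in> U \<Longrightarrow> dy k f z = 0"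
    and S: "\<And>z. z \<in> U \<Longrightarrow> S z = (\<Sum>i\<in>UNIV. dy i (\<lambda>z. G z $ i) z) - (\<Sum>m\<in>UNIV. snd z $ m * dx m f z)"
    and H: "\<And>z. z \<in> U \<Longrightarrow> H z = G z - (S z / (real CARD('n) + 1)) *\<^sub>R snd z"
    and z: "z \<in> U"
  shows "riemann2 H i k z = ricci_scalar H z * (if i = k then 1 else 0) - 1 / 2 * dy k (ricci_scalar H) z * snd z $ i"
proof -
  let ?c = "- 1 / (real CARD('n) + 1)"
  define P where "P z = ?c * ((\<Sum>i\<in>UNIV. dy i (\<lambda>z. G z $ i) z) - (\<Sum>m\<in>UNIV. snd z $ m * dx m f z))" for z
  have hf: "homogeneous 0 f" using f by (simp add: homogeneous_def)
  have hN: "homogeneous 1 (dy j (\<lambda>z. G z $ i))" for i j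
    using homogeneous_dy[OF G[of i], of j] by simp
  have hP: "homogeneous 1 P" unfolding P_def[abs_def]
    using homogeneous_mult[OF homogeneous_y homogeneous_dx[OF hf]]
    by (intro homogeneous_cmult homogeneous_diff homogeneous_sum hN) simp
  have HP: "H z $ i = G z $ i + P z * snd z $ i" if "z \<in> U" for z i
    unfolding H[OF that] S[OF that] P_def by simp
  have hH: "homogeneous 2 (\<lambda>z. H z $ i)" for i
  proof -
    have "homogeneous 2 (\<lambda>z. G z $ i + P z * snd z $ i)"
      using homogeneous_mult[OF hP homogeneous_y] by (intro homogeneous_add G) simp
    then show ?thesis using homogeneous_cong[of "\<lambda>z. H z $ i" "\<lambda>z. G z $ i + P z * snd z $ i" 2] HP by simp
  qed
  \<comment> \<open>For P of degree one the divergence of P y^i is y^i P_.i + n P = (n + 1) P; this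
    is the origin of the factor 1 / (n + 1).\<close>
  have div: "(\<Sum>i\<in>UNIV. dy i (\<lambda>z. H z $ i) w) = (\<Sum>m\<in>UNIV. snd w $ m * dx m f w)" if w: "w \<in> U" for w
  proof -
    have "dy i (\<lambda>z. H z $ i) w = dy i (\<lambda>z. G z $ i) w + (snd w $ i * dy i P w + P w)" for i
    proof -
      have "dy i (\<lambda>z. H z $ i) w = dy i (\<lambda>z. G z $ i + P z * snd z $ i) w"
        by (rule dy_cong[OF HP w])
      then show ?thesis using homogeneous_sm[OF G] homogeneous_sm[OF hP] w by simp
    qed
    then have "(\<Sum>i\<in>UNIV. dy i (\<lambda>z. H z $ i) w)
        = (\<Sum>i\<in>UNIV. dy i (\<lambda>z. G z $ i) w) + (real CARD('n) + 1) * P w"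
      using euler[OF hP w] by (simp add: sum.distrib algebra_simps)
    also have "(real CARD('n) + 1) * P w = - ((\<Sum>i\<in>UNIV. dy i (\<lambda>z. G z $ i) w) - (\<Sum>m\<in>UNIV. snd w $ m * dx m f w))"
      by (simp add: P_def add_nonneg_eq_0_iff)
    finally show ?thesis by simp
  qed
  have scalH: "\<exists>\<rho> \<tau>. \<forall>i k. berwald_R H i k w = \<rho> * (if i = k then 1 else 0) - \<tau> k * snd w $ i" if w: "w \<in> U" for w
  proof -
    obtain \<tau> where \<tau>: "\<And>i k. riemann2 G i k w = ricci_scalar G w * (if i = k then 1 else 0) - \<tau> k * snd w $ i"
      using scal[OF w] by blast
    obtain \<Xi> \<tau>' where \<tau>': "\<And>i k. berwald_R H i k w = berwald_R G i k w + \<Xi> * (if i = k then 1 else 0) - \<tau>' k * snd w $ i"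
      using berwald_R_projective[OF G hP HP w] by blast
    have "berwald_R H i k w = (ricci_scalar G w + \<Xi>) * (if i = k then 1 else 0) - (\<tau> k + \<tau>' k) * snd w $ i" for i k
      using \<tau>'[of i k] \<tau>[of i k] riemann2_eq_berwald_R[OF G w, of i k] by (simp add: algebra_simps)
    then show ?thesis
      by (intro exI[of _ "ricci_scalar G w + \<Xi>"] exI[of _ "\<lambda>k. \<tau> k + \<tau>' k"] allI)
  qed
  show ?thesis by (rule isotropic_of_closed_divergence[OF hH n y0 scalH f div z])
qed

end

section \<open>Change of coordinates\<close>

lemma linear_axis_sum:
  fixes f :: "real^'n \<Rightarrow> 'b::real_vector"
  assumes "linear f" shows "f y = (\<Sum>j\<in>UNIV. y $ j *\<^sub>R f (axis j 1))"
proof -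
  have "f y = f (\<Sum>j\<in>UNIV. y $ j *\<^sub>R axis j 1)"
    using basis_expansion[of y] by (simp add: scalar_mult_eq_scaleR)
  also have "\<dots> = (\<Sum>j\<in>UNIV. y $ j *\<^sub>R f (axis j 1))"
    using assms by (simp add: linear_sum linear_cmul)
  finally show ?thesis .
qed

section \<open>The logarithmic derivative of a determinant\<close>

text \<open>Jacobi's formula at the identity. A Leibniz summand with p \<noteq> id has at most one
  factor differentiated, but p moves at least two points, so an off-diagonal entry 0 remains as a
  factor.\<close>

lemma has_derivative_det_mat_1:
  fixes A :: "'a::real_normed_vector \<Rightarrow> real^'n^'n"
  assumes A: "\<And>i j. ((\<lambda>x. A x $ i $ j) has_derivative (\<lambda>v. A' v $ i $ j)) (at x)" and 1: "A x = mat 1"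
  shows "((\<lambda>x. det (A x)) has_derivative (\<lambda>v. trace (A' v))) (at x)"
proof -
  let ?P = "{p. p permutes (UNIV :: 'n set)}"
  have "((\<lambda>x. \<Sum>p\<in>?P. of_int (sign p) * (\<Prod>i\<in>UNIV. A x $ i $ p i)) has_derivative
    (\<lambda>v. \<Sum>p\<in>?P. of_int (sign p) * (\<Sum>i\<in>UNIV. A' v $ i $ p i * (\<Prod>j\<in>UNIV - {i}. A x $ j $ p j)))) (at x)"
    by (intro has_derivative_sum has_derivative_mult_right has_derivative_prod A)
  moreover have "(\<Sum>p\<in>?P. of_int (sign p) * (\<Sum>i\<in>UNIV. A' v $ i $ p i * (\<Prod>j\<in>UNIV - {i}. A x $ j $ p j)))
      = trace (A' v)" for v
  proof -
    have z: "(\<Prod>j\<in>UNIV - {i}. A x $ j $ p j) = 0" if "p permutes UNIV" "p \<noteq> id" for p i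
    proof -
      obtain j where j: "p j \<noteq> j" using \<open>p \<noteq> id\<close> by (auto simp: fun_eq_iff)
      then have "p (p j) \<noteq> p j" using permutes_inj[OF that(1)] by (auto dest: injD)
      then obtain l where "l \<noteq> i" "p l \<noteq> l" using j by metis
      then show ?thesis unfolding 1 by (intro prod_zero) (auto simp: mat_def intro!: bexI[of _ l])
    qed
    have "(\<Sum>p\<in>?P. of_int (sign p) * (\<Sum>i\<in>UNIV. A' v $ i $ p i * (\<Prod>j\<in>UNIV - {i}. A x $ j $ p j)))
      = (\<Sum>p\<in>{id}. of_int (sign p) * (\<Sum>i\<in>UNIV. A' v $ i $ p i * (\<Prod>j\<in>UNIV - {i}. A x $ j $ p j)))"
    proof (rule sum.mono_neutral_right)
      show "\<forall>p\<in>?P - {id}. of_int (sign p) * (\<Sum>i\<in>UNIV. A' v $ i $ p i * (\<Prod>j\<in>UNIV - {i}. A x $ j $ p j)) = 0"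
        by (auto simp del: prod_zero_iff simp: z)
    qed (auto simp: permutes_id finite_permutations)
    then show ?thesis by (simp add: sign_id 1 mat_def trace_def)
  qed
  ultimately show ?thesis by (simp add: det_def)
qed

text \<open>Multiplication by the constant matrix B moves the base point to the identity. Near x,
  det (B A) is positive, so \<bar>det A\<bar> = det (B A) / \<bar>det B\<bar> and no case
  distinction on the sign of det A arises.\<close>

lemma has_derivative_ln_abs_det:
  fixes A :: "'a::real_normed_vector \<Rightarrow> real^'n^'n"
  assumes A: "\<And>i j. ((\<lambda>x. A x $ i $ j) has_derivative (\<lambda>v. A' v $ i $ j)) (at x)" and B: "B ** A x = mat 1"
  shows "((\<lambda>x. ln \<bar>det (A x)\<bar>) has_derivative (\<lambda>v. trace (B ** A' v))) (at x)"
proof -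
  let ?d = "\<lambda>x. det (B ** A x)"
  have d: "(?d has_derivative (\<lambda>v. trace (B ** A' v))) (at x)"
    by (rule has_derivative_det_mat_1)
      (auto simp: matrix_matrix_mult_def B[unfolded matrix_matrix_mult_def] intro!: has_derivative_sum has_derivative_mult_right A)
  have d1: "?d x = 1" by (simp add: B)
  have dB: "det B \<noteq> 0" using d1 by (auto simp: det_mul)
  have "((\<lambda>x. ln (?d x) - ln \<bar>det B\<bar>) has_derivative (\<lambda>v. trace (B ** A' v))) (at x)"
    using has_derivative_diff[OF has_derivative_ln[OF _ d] has_derivative_const] d1 by simp
  moreover have "\<forall>\<^sub>F y in at x. ln (?d y) - ln \<bar>det B\<bar> = ln \<bar>det (A y)\<bar>"
  proof -
    have "isCont ?d x" using has_derivative_continuous[OF d] by simp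
    then have "\<forall>\<^sub>F y in at x. ?d y > 0"
      using d1 by (intro order_tendstoD(1)[where y = 1]) (auto simp: isCont_def)
    then show ?thesis
    proof eventually_elim
      case (elim y)
      then have "?d y = \<bar>det B\<bar> * \<bar>det (A y)\<bar>" "det (A y) \<noteq> 0"
        by (auto simp: det_mul abs_mult[symmetric])
      then show ?case using dB by (simp add: ln_mult)
    qed
  qed
  ultimately show ?thesis
  proof (rule has_derivative_transform_eventually)
    show "ln (?d x) - ln \<bar>det B\<bar> = ln \<bar>det (A x)\<bar>"
    proof -
      have "\<bar>det B\<bar> * \<bar>det (A x)\<bar> = 1" using d1 by (simp add: det_mul flip: abs_mult)
      moreover have "det (A x) \<noteq> 0" using d1 by (auto simp: det_mul)
      ultimately have "ln \<bar>det B\<bar> + ln \<bar>det (A x)\<bar> = 0" using dB ln_mult[of "\<bar>det B\<bar>" "\<bar>det (A x)\<bar>"] by simp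
      then show ?thesis by (simp add: d1)
    qed
  qed auto
qed

lemma frechet_commute_vec:
  fixes f :: "'a::real_normed_vector \<Rightarrow> real^'n"
  assumes "open S" "smooth_on S f" "z \<in> S"
  shows "frechet_derivative (\<lambda>x. frechet_derivative f (at x) b) (at z) a =
    frechet_derivative (\<lambda>x. frechet_derivative f (at x) a) (at z) b"
proof -
  have comp: "frechet_derivative (\<lambda>x. g x $ i) (at x) v = frechet_derivative g (at x) v $ i"
    if "smooth_on S g" "x \<in> S" for g :: "'a \<Rightarrow> real^'n" and x v i
    by (simp add: frechet_eqI[OF bounded_linear.has_derivative[OF bounded_linear_vec_nth smooth_on_has_derivative[OF that]]])
  have "frechet_derivative (\<lambda>x. frechet_derivative f (at x) b) (at z) a $ i =
      frechet_derivative (\<lambda>x. frechet_derivative (\<lambda>x. f x $ i) (at x) b) (at z) a" for a b i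
  proof -
    have "frechet_derivative (\<lambda>x. frechet_derivative (\<lambda>x. f x $ i) (at x) b) (at z)
      = frechet_derivative (\<lambda>x. frechet_derivative f (at x) b $ i) (at z)"
      using comp[OF assms(2)] by (intro frechet_cong[OF assms(1,3)]) auto
    then show ?thesis using comp[OF smooth_on_derivative[OF assms(2)] assms(3)] by simp
  qed
  moreover have "smooth_on S (\<lambda>x. f x $ i)" for i
    using smooth_on_linear_compose[OF bounded_linear_vec_nth assms(1,2)] .
  ultimately show ?thesis using frechet_commute[OF assms(1) _ assms(3)] by (simp add: vec_eq_iff)
qed

section \<open>Invariance of the S-curvature under a coordinate change\<close>

locale coordinate_change =
  fixes W :: "(real^'n) set" and T :: "real^'n \<Rightarrow> real^'n"
  assumes open_W: "open W" and smooth_T: "smooth_on W T"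
begin

definition J where "J x = frechet_derivative T (at x)"
text \<open>\<open>K x\<close> is the second differential of T at x as a bilinear map, and
  \<open>\<Phi>\<close> is the tangent map of T.\<close>

definition K where "K x a b = frechet_derivative (\<lambda>x. J x b) (at x) a"
definition \<Phi> where "\<Phi> = (\<lambda>(x, y). (T x, J x y))"

lemma T_deriv: "x \<in> W \<Longrightarrow> (T has_derivative J x) (at x)"
  unfolding J_def by (rule smooth_on_has_derivative[OF smooth_T])

lemma linear_J: "x \<in> W \<Longrightarrow> linear (J x)"
  using T_deriv has_derivative_linear by blast

lemma smooth_J: "smooth_on W (\<lambda>x. J x b)"
  unfolding J_def by (rule smooth_on_derivative[OF smooth_T])

lemma J_deriv: "x \<in> W \<Longrightarrow> ((\<lambda>x. J x b) has_derivative (\<lambda>a. K x a b)) (at x)"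
  unfolding K_def using smooth_on_has_derivative[OF smooth_J] by simp

lemma K_sym: "x \<in> W \<Longrightarrow> K x a b = K x b a"
  unfolding K_def J_def by (rule frechet_commute_vec[OF open_W smooth_T])

lemma linear_K1: "x \<in> W \<Longrightarrow> linear (\<lambda>a. K x a b)"
  using J_deriv has_derivative_linear by blast

lemma linear_K2: "x \<in> W \<Longrightarrow> linear (K x a)"
  using linear_K1[of x a] K_sym[of x _ a] by simp

lemma \<Phi>_deriv:
  assumes "x \<in> W"
  shows "(\<Phi> has_derivative (\<lambda>(a, b). (J x a, K x a y + J x b))) (at (x, y))"
proof -
  have f: "((\<lambda>z. fst z) has_derivative (\<lambda>v. fst v)) (at (x, y))"
    by (auto intro!: derivative_eq_intros)
  have 1: "((\<lambda>z. J (fst z) b) has_derivative (\<lambda>v. K x (fst v) b)) (at (x, y))" for b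
    using has_derivative_compose[OF f, of "\<lambda>x. J x b" "\<lambda>a. K x a b"] J_deriv[OF assms, of b] by simp
  have 2: "((\<lambda>z. T (fst z)) has_derivative (\<lambda>v. J x (fst v))) (at (x, y))"
    using has_derivative_compose[OF f, of T "J x"] T_deriv[OF assms] by simp
  have 3: "((\<lambda>z. snd z $ j) has_derivative (\<lambda>v. snd v $ j)) (at (x, y))" for j :: 'n
    by (rule bounded_linear_imp_has_derivative[OF bounded_linear_y])
  \<comment> \<open>\<open>J_deriv\<close> differentiates J x b for fixed b, so J x y is expanded in
    the standard basis before the product rule is applied.\<close>
  have "((\<lambda>z. (T (fst z), \<Sum>j\<in>UNIV. snd z $ j *\<^sub>R J (fst z) (axis j 1))) has_derivative
    (\<lambda>v. (J x (fst v), \<Sum>j\<in>UNIV. snd (x, y) $ j *\<^sub>R K x (fst v) (axis j 1) + snd v $ j *\<^sub>R J (fst (x, y)) (axis j 1)))) (at (x, y))"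
    by (intro has_derivative_Pair has_derivative_sum has_derivative_scaleR 1 2 3)
  moreover have "(\<Sum>j\<in>UNIV. snd (x, y) $ j *\<^sub>R K x a (axis j 1) + b $ j *\<^sub>R J (fst (x, y)) (axis j 1)) = K x a y + J x b" for a b
    using linear_axis_sum[OF linear_K2[OF assms], of a y] linear_axis_sum[OF linear_J[OF assms], of b]
    by (simp add: sum.distrib)
  ultimately have "((\<lambda>z. (T (fst z), \<Sum>j\<in>UNIV. snd z $ j *\<^sub>R J (fst z) (axis j 1))) has_derivative
    (\<lambda>(a, b). (J x a, K x a y + J x b))) (at (x, y))" by (simp add: case_prod_unfold)
  then show ?thesis
  proof (rule has_derivative_transform_within_open)
    show "open (W \<times> (UNIV :: (real^'n) set))" using open_W by (intro open_Times) auto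
    show "(T (fst z), \<Sum>j\<in>UNIV. snd z $ j *\<^sub>R J (fst z) (axis j 1)) = \<Phi> z" if "z \<in> W \<times> UNIV" for z
      using that linear_axis_sum[OF linear_J] by (auto simp: \<Phi>_def)
  qed (use assms in auto)
qed

text \<open>Here g and h are the coefficients of a spray in two charts and \<open>gh\<close> is
  their transformation law. Differentiating it along the fibre gives h' J = J g' - K y, hence tr h'
  = tr g' - tr (L (K y)). By Jacobi's formula the derivative of ln \<sigma> in direction y is that
  of ln \<sigma>' in direction J y plus the same tr (L (K y)).\<close>

lemma S_invariant:
  fixes g h :: "(real^'n) \<times> (real^'n) \<Rightarrow> real^'n" and \<sigma> \<sigma>' :: "real^'n \<Rightarrow> real"
  assumes x: "x \<in> W" and y: "y \<noteq> 0" and inv: "\<And>w. L (J x w) = w" "linear L"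
    and g: "g differentiable (at (x, y))" and h: "h differentiable (at (T x, J x y))"
    and gh: "\<And>y. y \<noteq> 0 \<Longrightarrow> - 2 *\<^sub>R h (T x, J x y) = K x y y - 2 *\<^sub>R J x (g (x, y))"
    and \<sigma>: "\<And>x. x \<in> W \<Longrightarrow> \<sigma> x = \<bar>det (matrix (J x))\<bar> * \<sigma>' (T x)"
    and \<sigma>_pos: "\<And>x. x \<in> W \<Longrightarrow> \<sigma> x > 0"
    and \<sigma>': "\<sigma>' differentiable (at (T x))"
  shows "(\<Sum>m\<in>UNIV. dy m (\<lambda>z. g z $ m) (x, y)) - (\<Sum>m\<in>UNIV. y $ m * frechet_derivative (\<lambda>x. ln (\<sigma> x)) (at x) (axis m 1))
    = (\<Sum>m\<in>UNIV. dy m (\<lambda>z. h z $ m) (T x, J x y))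
      - (\<Sum>m\<in>UNIV. J x y $ m * frechet_derivative (\<lambda>x. ln (\<sigma>' x)) (at (T x)) (axis m 1))"
proof -
  define g' where "g' = (\<lambda>w. frechet_derivative g (at (x, y)) (0, w))"
  define h' where "h' = (\<lambda>w. frechet_derivative h (at (T x, J x y)) (0, w))"
  have embed: "linear (\<lambda>w::real^'n. (0::real^'n, w))" by (auto intro!: linearI)
  have lin: "linear g'" "linear h'" unfolding g'_def h'_def
    using linear_compose[OF embed has_derivative_linear[OF has_derivative_frechet[OF g]]]
      linear_compose[OF embed has_derivative_linear[OF has_derivative_frechet[OF h]]]
    by (simp_all add: o_def)
  have lJ: "linear (J x)" and lK: "linear (K x y)" using linear_J[OF x] linear_K2[OF x] by auto
  have dyg: "dy m (\<lambda>z. g z $ i) (x, y) = g' (axis m 1) $ i" for i m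
    unfolding dy_def g'_def
    by (simp add: frechet_eqI[OF bounded_linear.has_derivative[OF bounded_linear_vec_nth has_derivative_frechet[OF g]]])
  have dyh: "dy m (\<lambda>z. h z $ i) (T x, J x y) = h' (axis m 1) $ i" for i m
    unfolding dy_def h'_def
    by (simp add: frechet_eqI[OF bounded_linear.has_derivative[OF bounded_linear_vec_nth has_derivative_frechet[OF h]]])
  have rel: "h' (J x w) = J x (g' w) - K x y w" for w
  proof -
    have dl: "((\<lambda>t. y + t *\<^sub>R w) has_derivative (\<lambda>t. t *\<^sub>R w)) (at 0)"
      by (auto intro!: derivative_eq_intros)
    have y0: "y + 0 *\<^sub>R w = y" by simp
    have bJ: "bounded_linear (J x)" using T_deriv[OF x] has_derivative_bounded_linear by blast
    have "((\<lambda>t. - 2 *\<^sub>R h (T x, J x (y + t *\<^sub>R w))) has_derivative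
        (\<lambda>t. - 2 *\<^sub>R frechet_derivative h (at (T x, J x y)) (0, J x (t *\<^sub>R w)))) (at 0)"
      using has_derivative_frechet[OF h]
      by (intro has_derivative_scaleR_right has_derivative_compose[where f = "\<lambda>t. (T x, J x (y + t *\<^sub>R w))" and g = h]
          has_derivative_Pair has_derivative_const bounded_linear.has_derivative[OF bJ] dl) simp
    moreover have "((\<lambda>t. K x (y + t *\<^sub>R w) (y + t *\<^sub>R w) - 2 *\<^sub>R J x (g (x, y + t *\<^sub>R w))) has_derivative
        (\<lambda>t. (K x y (t *\<^sub>R w) + K x (t *\<^sub>R w) y) - 2 *\<^sub>R J x (frechet_derivative g (at (x, y)) (0, t *\<^sub>R w)))) (at 0)"
    proof (intro has_derivative_diff has_derivative_scaleR_right bounded_linear.has_derivative[OF bJ])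
      show "((\<lambda>t. g (x, y + t *\<^sub>R w)) has_derivative (\<lambda>t. frechet_derivative g (at (x, y)) (0, t *\<^sub>R w))) (at 0)"
        using has_derivative_frechet[OF g]
        by (intro has_derivative_compose[where f = "\<lambda>t. (x, y + t *\<^sub>R w)" and g = g]
          has_derivative_Pair has_derivative_const dl) simp
      \<comment> \<open>An exact quadratic polynomial in t; its linear coefficient is the derivative
        at 0.\<close>
      have "K x (y + t *\<^sub>R w) (y + t *\<^sub>R w) = K x y y + (t *\<^sub>R (K x y w + K x w y) + t\<^sup>2 *\<^sub>R K x w w)" for t
        using linear_K1[OF x] linear_K2[OF x]
        by (simp add: linear_add linear_cmul power2_eq_square scaleR_add_right linear_add[OF linear_K1[OF x]] linear_cmul[OF linear_K1[OF x]])
      moreover have "K x y (t *\<^sub>R w) + K x (t *\<^sub>R w) y = t *\<^sub>R (K x y w + K x w y)" for t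
        using linear_K1[OF x] linear_K2[OF x]
        by (simp add: linear_cmul scaleR_add_right linear_cmul[OF linear_K1[OF x]])
      ultimately show "((\<lambda>t. K x (y + t *\<^sub>R w) (y + t *\<^sub>R w)) has_derivative (\<lambda>t. K x y (t *\<^sub>R w) + K x (t *\<^sub>R w) y)) (at 0)"
        by (auto intro!: derivative_eq_intros)
    qed
    \<comment> \<open>The law \<open>gh\<close> is available only at nonzero vectors, and y + t w is
      nonzero for t near 0.\<close>
    moreover have "\<forall>\<^sub>F t in at 0. - 2 *\<^sub>R h (T x, J x (y + t *\<^sub>R w)) =
        K x (y + t *\<^sub>R w) (y + t *\<^sub>R w) - 2 *\<^sub>R J x (g (x, y + t *\<^sub>R w))"
    proof -
      have "((\<lambda>t. y + t *\<^sub>R w) \<longlongrightarrow> y) (at 0)" using has_derivative_continuous[OF dl] by (simp add: isCont_def)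
      then have "\<forall>\<^sub>F t in at 0. y + t *\<^sub>R w \<noteq> 0" using y tendsto_imp_eventually_ne by blast
      then show ?thesis by eventually_elim (rule gh)
    qed
    ultimately have "((\<lambda>t. K x (y + t *\<^sub>R w) (y + t *\<^sub>R w) - 2 *\<^sub>R J x (g (x, y + t *\<^sub>R w))) has_derivative
        (\<lambda>t. - 2 *\<^sub>R frechet_derivative h (at (T x, J x y)) (0, J x (t *\<^sub>R w)))) (at 0)"
      and "((\<lambda>t. K x (y + t *\<^sub>R w) (y + t *\<^sub>R w) - 2 *\<^sub>R J x (g (x, y + t *\<^sub>R w))) has_derivative
        (\<lambda>t. (K x y (t *\<^sub>R w) + K x (t *\<^sub>R w) y) - 2 *\<^sub>R J x (frechet_derivative g (at (x, y)) (0, t *\<^sub>R w)))) (at 0)"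
      using has_derivative_transform_eventually gh[OF y] y0 by fastforce+
    from has_derivative_unique[OF this]
    have "- 2 *\<^sub>R frechet_derivative h (at (T x, J x y)) (0, J x (1 *\<^sub>R w)) =
      (K x y (1 *\<^sub>R w) + K x (1 *\<^sub>R w) y) - 2 *\<^sub>R J x (frechet_derivative g (at (x, y)) (0, 1 *\<^sub>R w))" by (rule fun_cong)
    then have "- 2 *\<^sub>R h' (J x w) = 2 *\<^sub>R K x y w - 2 *\<^sub>R J x (g' w)"
      using K_sym[OF x, of w y] by (simp add: h'_def g'_def scaleR_2)
    then have "(- 1/2) *\<^sub>R (- 2 *\<^sub>R h' (J x w)) = (- 1/2) *\<^sub>R (2 *\<^sub>R K x y w - 2 *\<^sub>R J x (g' w))" by simp
    then show ?thesis by (simp add: scaleR_diff_right)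
  qed
  define matJ where "matJ = matrix (J x)"
  define matL where "matL = matrix L"
  have LJ: "matL ** matJ = mat 1"
  proof -
    have "matL ** matJ = matrix (L \<circ> J x)"
      unfolding matL_def matJ_def by (rule matrix_compose[OF lJ inv(2), symmetric])
    also have "L \<circ> J x = id" using inv(1) by (simp add: fun_eq_iff)
    finally show ?thesis by (simp only: matrix_id_mat_1)
  qed
  have JL: "matJ ** matL = mat 1" using LJ matrix_left_right_inverse by blast
  have "matrix h' ** matJ = matrix (h' \<circ> J x)"
    unfolding matJ_def by (rule matrix_compose[OF lJ lin(2), symmetric])
  also have "h' \<circ> J x = (\<lambda>w. (J x \<circ> g') w - K x y w)"
    using rel by (simp add: fun_eq_iff)
  also have "matrix \<dots> = matrix (J x \<circ> g') - matrix (K x y)"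
    by (simp add: matrix_def vec_eq_iff)
  also have "matrix (J x \<circ> g') = matJ ** matrix g'"
    unfolding matJ_def by (rule matrix_compose[OF lin(1) lJ])
  finally have M: "matrix h' ** matJ = matJ ** matrix g' - matrix (K x y)" .
  \<comment> \<open>As matrices, h' = (J g' - K y) L, and cyclic invariance of the trace moves L to
    the front.\<close>
  have "matrix h' = (matrix h' ** matJ) ** matL"
    by (simp only: matrix_mul_assoc[symmetric] JL matrix_mul_rid)
  then have "trace (matrix h') = trace (matL ** (matJ ** matrix g' - matrix (K x y)))"
    unfolding M by (metis trace_mul_sym)
  also have "matL ** (matJ ** matrix g' - matrix (K x y)) = matL ** (matJ ** matrix g') - matL ** matrix (K x y)"
    by (simp add: matrix_matrix_mult_def vec_eq_iff right_diff_distrib sum_subtractf)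
  also have "matL ** (matJ ** matrix g') = matrix g'"
    by (simp only: matrix_mul_assoc LJ matrix_mul_lid)
  finally have tr: "trace (matrix h') = trace (matrix g') - trace (matL ** matrix (K x y))"
    by (simp only: trace_sub)
  \<comment> \<open>Positivity of \<sigma> and the product formula for it force the Jacobian
    determinant to be nonzero and \<sigma>' to be positive.\<close>
  have detJ: "det (matrix (J x)) \<noteq> 0" if "x \<in> W" for x using \<sigma>_pos[OF that] \<sigma>[OF that] by auto
  have pos': "\<sigma>' (T x) > 0" if "x \<in> W" for x using \<sigma>_pos[OF that] \<sigma>[OF that] by (simp add: zero_less_mult_iff)
  have dl': "((\<lambda>x. ln (\<sigma>' x)) has_derivative frechet_derivative (\<lambda>x. ln (\<sigma>' x)) (at (T x))) (at (T x))"
    using has_derivative_ln[OF pos'[OF x] has_derivative_frechet[OF \<sigma>']]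
    by (intro has_derivative_frechet) (auto simp: differentiable_def)
  have "((\<lambda>x. ln \<bar>det (matrix (J x))\<bar>) has_derivative (\<lambda>v. trace (matL ** matrix (K x v)))) (at x)"
  proof (rule has_derivative_ln_abs_det)
    show "((\<lambda>x. matrix (J x) $ i $ j) has_derivative (\<lambda>v. matrix (K x v) $ i $ j)) (at x)" for i j
      by (simp add: matrix_def bounded_linear.has_derivative[OF bounded_linear_vec_nth J_deriv[OF x]])
  qed (use LJ matJ_def in simp)
  from has_derivative_add[OF this has_derivative_compose[OF T_deriv[OF x] dl']]
  have "((\<lambda>x. ln (\<sigma> x)) has_derivative (\<lambda>v. trace (matL ** matrix (K x v)) + frechet_derivative (\<lambda>x. ln (\<sigma>' x)) (at (T x)) (J x v))) (at x)"
    (is "(_ has_derivative ?D) _")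
  proof (rule has_derivative_transform_within_open[OF _ open_W x])
    show "ln \<bar>det (matrix (J x))\<bar> + ln (\<sigma>' (T x)) = ln (\<sigma> x)" if "x \<in> W" for x
      unfolding \<sigma>[OF that] using detJ[OF that] pos'[OF that] by (simp add: ln_mult)
  qed
  then have dD: "frechet_derivative (\<lambda>x. ln (\<sigma> x)) (at x) = ?D" and "linear ?D"
    by (rule frechet_eqI, rule has_derivative_linear)
  then have 1: "(\<Sum>m\<in>UNIV. y $ m * frechet_derivative (\<lambda>x. ln (\<sigma> x)) (at x) (axis m 1)) = ?D y"
    unfolding dD using linear_axis_sum[of ?D y] by (simp only: real_scaleR_def)
  have 2: "(\<Sum>m\<in>UNIV. J x y $ m * frechet_derivative (\<lambda>x. ln (\<sigma>' x)) (at (T x)) (axis m 1))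
      = frechet_derivative (\<lambda>x. ln (\<sigma>' x)) (at (T x)) (J x y)"
    using linear_axis_sum[OF has_derivative_linear[OF dl'], of "J x y"] by simp
  have "(\<Sum>m\<in>UNIV. dy m (\<lambda>z. g z $ m) (x, y)) = trace (matrix g')"
    "(\<Sum>m\<in>UNIV. dy m (\<lambda>z. h z $ m) (T x, J x y)) = trace (matrix h')"
    unfolding dyg dyh by (simp_all add: trace_def matrix_def)
  then show ?thesis unfolding 1 2 tr by simp
qed

end

section \<open>Charts of the slit tangent bundle\<close>

lemma tangent_space_transform:
  "v \<in> tangent_space N p \<Longrightarrow> c \<in> charts N \<Longrightarrow> d \<in> charts N \<Longrightarrow> p \<in> chart_dom N c \<Longrightarrow> p \<in> chart_dom N d \<Longrightarrow>
    v d = frechet_derivative (transition N c d) (at (coord N c p)) (v c)"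
  unfolding tangent_space_def by blast

lemma tangent_space_outside:
  "v \<in> tangent_space N p \<Longrightarrow> \<not> (c \<in> charts N \<and> p \<in> chart_dom N c) \<Longrightarrow> v c = 0"
  unfolding tangent_space_def by blast

locale manifold =
  fixes M :: "('p, 'c, real^'n) atlas"
  assumes smooth_manifold: "smooth_manifold M"
begin

definition overlap :: "'c \<Rightarrow> 'c \<Rightarrow> (real^'n) set" where
  "overlap c d = coord M c ` (chart_dom M c \<inter> chart_dom M d)"

abbreviation jac :: "'c \<Rightarrow> 'c \<Rightarrow> real^'n \<Rightarrow> real^'n \<Rightarrow> real^'n" where
  "jac c d x \<equiv> frechet_derivative (transition M c d) (at x)"

lemma inj_coord: "c \<in> charts M \<Longrightarrow> inj_on (coord M c) (chart_dom M c)"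
  using smooth_manifold by (simp add: smooth_manifold_def)

lemma points_iff: "p \<in> points M \<longleftrightarrow> (\<exists>c\<in>charts M. p \<in> chart_dom M c)"
  using smooth_manifold by (auto simp: smooth_manifold_def)

lemma chart_inv_coord: "c \<in> charts M \<Longrightarrow> p \<in> chart_dom M c \<Longrightarrow> chart_inv M c (coord M c p) = p"
  by (simp add: chart_inv_def inj_coord inv_into_f_f)

lemma transition_coord:
  "c \<in> charts M \<Longrightarrow> p \<in> chart_dom M c \<Longrightarrow> transition M c d (coord M c p) = coord M d p"
  by (simp add: transition_def chart_inv_coord)

lemma coordinate_change_overlap:
  "c \<in> charts M \<Longrightarrow> d \<in> charts M \<Longrightarrow> coordinate_change (overlap c d) (transition M c d)"
  using smooth_manifold by unfold_locales (auto simp: smooth_manifold_def overlap_def)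

lemma open_overlap: "c \<in> charts M \<Longrightarrow> d \<in> charts M \<Longrightarrow> open (overlap c d)"
  using coordinate_change_overlap coordinate_change.open_W by blast

lemma open_chart: "c \<in> charts M \<Longrightarrow> open (coord M c ` chart_dom M c)"
  using open_overlap[of c c] by (simp add: overlap_def)

lemma linear_jac:
  assumes "c \<in> charts M" "d \<in> charts M" "p \<in> chart_dom M c" "p \<in> chart_dom M d"
  shows "linear (jac c d (coord M c p))"
proof -
  interpret cc: coordinate_change "overlap c d" "transition M c d"
    using assms coordinate_change_overlap by blast
  show ?thesis using cc.linear_J[of "coord M c p"] assms by (simp add: overlap_def cc.J_def)
qed

lemma jac_self:
  assumes "c \<in> charts M" "p \<in> chart_dom M c"
  shows "jac c c (coord M c p) v = v"
proof -
  have "jac c c (coord M c p) = frechet_derivative (\<lambda>x. x) (at (coord M c p))"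
    using assms by (intro frechet_cong[OF open_chart[OF assms(1)]]) (auto simp: transition_coord)
  then show ?thesis by (simp add: frechet_eqI[OF has_derivative_ident])
qed

lemma jac_compose:
  assumes c: "c \<in> charts M" "p \<in> chart_dom M c" and d: "d \<in> charts M" "p \<in> chart_dom M d"
    and e: "e \<in> charts M" "p \<in> chart_dom M e"
  shows "jac c e (coord M c p) v = jac d e (coord M d p) (jac c d (coord M c p) v)"
proof -
  interpret cd: coordinate_change "overlap c d" "transition M c d"
    using c d coordinate_change_overlap by blast
  interpret de: coordinate_change "overlap d e" "transition M d e"
    using d e coordinate_change_overlap by blast
  let ?x = "coord M c p"
  have x: "?x \<in> overlap c d" "?x \<in> overlap c e" "coord M d p \<in> overlap d e" using c d e by (auto simp: overlap_def)
  have "(transition M d e has_derivative jac d e (coord M d p)) (at (transition M c d ?x))"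
    using de.T_deriv[OF x(3)] unfolding transition_coord[OF c] de.J_def .
  from has_derivative_compose[OF cd.T_deriv[OF x(1), unfolded cd.J_def] this]
  have "((\<lambda>x. transition M d e (transition M c d x)) has_derivative
      (\<lambda>v. jac d e (coord M d p) (jac c d ?x v))) (at ?x)" .
  then have "(transition M c e has_derivative (\<lambda>v. jac d e (coord M d p) (jac c d ?x v))) (at ?x)"
  proof (rule has_derivative_transform_within_open[where s = "overlap c d \<inter> overlap c e"])
    show "open (overlap c d \<inter> overlap c e)" using open_overlap c d e by blast
    fix x assume "x \<in> overlap c d \<inter> overlap c e"
    then obtain q where "q \<in> chart_dom M c" "q \<in> chart_dom M d" "x = coord M c q" by (auto simp: overlap_def)
    then show "transition M d e (transition M c d x) = transition M c e x"
      using c d by (simp add: transition_coord)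
  qed (use x in auto)
  from fun_cong[OF frechet_eqI[OF this], of v] show ?thesis .
qed

section \<open>Tangent vectors and their components\<close>

text \<open>The vector is y transported from the chart c to every other chart around p; the chain
  rule \<open>jac_compose\<close> is the compatibility condition. This makes the fibres of
  \<open>slit_image\<close> all of the nonzero vectors.\<close>

lemma tangent_exists:
  assumes c: "c \<in> charts M" "p \<in> chart_dom M c"
  shows "\<exists>v\<in>tangent_space M p. v c = y"
proof -
  define v where "v d = (if d \<in> charts M \<and> p \<in> chart_dom M d then jac c d (coord M c p) y else 0)" for d
  have "v \<in> tangent_space M p"
    unfolding tangent_space_def
  proof (intro CollectI conjI ballI allI impI)
    fix d e assume "d \<in> charts M" "e \<in> charts M" "p \<in> chart_dom M d \<inter> chart_dom M e"
    then show "v e = jac d e (coord M d p) (v d)"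
      using jac_compose[OF c, of d e y] by (simp add: v_def)
  qed (auto simp: v_def)
  moreover have "v c = y" using c by (simp add: v_def jac_self)
  ultimately show ?thesis by blast
qed

text \<open>The components in charts around p follow from the one in c, and all remaining indices
  carry the default value 0.\<close>

lemma tangent_eqI:
  assumes v: "v \<in> tangent_space M p" "w \<in> tangent_space M p" and c: "c \<in> charts M" "p \<in> chart_dom M c"
    and "v c = w c"
  shows "v = w"
proof
  fix d show "v d = w d"
  proof (cases "d \<in> charts M \<and> p \<in> chart_dom M d")
    case True
    then show ?thesis using tangent_space_transform[OF v(1) c(1) _ c(2)] tangent_space_transform[OF v(2) c(1) _ c(2)] assms(5) by simp
  next
    case False
    then show ?thesis using tangent_space_outside[OF v(1)] tangent_space_outside[OF v(2)] by simp
  qed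
qed

lemma tangent_nonzero:
  assumes v: "v \<in> tangent_space M p" "v \<noteq> (\<lambda>_. 0)" and c: "c \<in> charts M" "p \<in> chart_dom M c"
  shows "v c \<noteq> 0"
proof
  assume 0: "v c = 0"
  have "v d = 0" for d
  proof (cases "d \<in> charts M \<and> p \<in> chart_dom M d")
    case True
    then show ?thesis using tangent_space_transform[OF v(1) c(1) _ c(2), of d] 0 linear_0[OF linear_jac[OF c(1) _ c(2), of d]]
      by simp
  next
    case False
    then show ?thesis using tangent_space_outside[OF v(1)] by simp
  qed
  then show False using v(2) by auto
qed

section \<open>Chart images and transition maps of the slit tangent bundle\<close>

lemma slit_charts [simp]: "charts (slit_tangent M) = charts M"
  by (simp add: slit_tangent_def Let_def)

lemma slit_chart_dom [simp]: "(p, v) \<in> chart_dom (slit_tangent M) c \<longleftrightarrow>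
    p \<in> points M \<and> v \<in> tangent_space M p \<and> v \<noteq> (\<lambda>_. 0) \<and> p \<in> chart_dom M c"
  by (auto simp: slit_tangent_def Let_def)

lemma slit_points [simp]: "(p, v) \<in> points (slit_tangent M) \<longleftrightarrow>
    p \<in> points M \<and> v \<in> tangent_space M p \<and> v \<noteq> (\<lambda>_. 0)"
  by (auto simp: slit_tangent_def Let_def)

lemma slit_coord [simp]: "coord (slit_tangent M) c (p, v) = (coord M c p, v c)"
  by (simp add: slit_tangent_def Let_def)

lemma slit_vector:
  assumes "c \<in> charts M" "p \<in> chart_dom M c" "y \<noteq> 0"
  obtains v where "(p, v) \<in> chart_dom (slit_tangent M) c" "v c = y"
proof -
  obtain v where v: "v \<in> tangent_space M p" "v c = y" using tangent_exists assms by blast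
  then show ?thesis using that[of v] assms points_iff by auto
qed

lemma slit_vector_transform:
  assumes "c \<in> charts M" "d \<in> charts M"
    and "(p, v) \<in> chart_dom (slit_tangent M) c" "(p, v) \<in> chart_dom (slit_tangent M) d"
  shows "v d = jac c d (coord M c p) (v c)"
  by (rule tangent_space_transform) (use assms in auto)

lemma slit_image_eq:
  assumes c: "c \<in> charts M"
  shows "slit_image M c = coord M c ` chart_dom M c \<times> (- {0})"
proof (rule set_eqI, clarify)
  fix x y
  show "(x, y) \<in> slit_image M c \<longleftrightarrow> (x, y) \<in> coord M c ` chart_dom M c \<times> (- {0})"
  proof
    assume "(x, y) \<in> slit_image M c"
    then obtain p v where "(p, v) \<in> chart_dom (slit_tangent M) c" "x = coord M c p" "y = v c"
      by (force simp: slit_image_def)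
    then show "(x, y) \<in> coord M c ` chart_dom M c \<times> (- {0})" using tangent_nonzero c by auto
  next
    assume "(x, y) \<in> coord M c ` chart_dom M c \<times> (- {0})"
    then obtain p where p: "p \<in> chart_dom M c" "x = coord M c p" "y \<noteq> 0" by auto
    then obtain v where "(p, v) \<in> chart_dom (slit_tangent M) c" "v c = y" using slit_vector c by metis
    then show "(x, y) \<in> slit_image M c" using p unfolding slit_image_def
      by (intro image_eqI[of _ _ "(p, v)"]) auto
  qed
qed

lemma open_slit_image: "c \<in> charts M \<Longrightarrow> open (slit_image M c)"
  by (simp add: slit_image_eq open_Times open_chart open_Compl)

lemma slit_chart_inv:
  assumes c: "c \<in> charts M" and u: "u \<in> chart_dom (slit_tangent M) c"
  shows "chart_inv (slit_tangent M) c (coord (slit_tangent M) c u) = u"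
proof -
  have "inj_on (coord (slit_tangent M) c) (chart_dom (slit_tangent M) c)"
  proof (rule inj_onI)
    fix u w assume a: "u \<in> chart_dom (slit_tangent M) c" "w \<in> chart_dom (slit_tangent M) c"
      "coord (slit_tangent M) c u = coord (slit_tangent M) c w"
    obtain p v q v' where uw: "u = (p, v)" "w = (q, v')" by fastforce
    then have pq: "p = q" using a inj_onD[OF inj_coord[OF c]] by auto
    have "v = v'"
      by (rule tangent_eqI[of v p v' c]) (use a c uw pq in auto)
    then show "u = w" using uw pq by simp
  qed
  then show ?thesis using u by (simp add: chart_inv_def inv_into_f_f)
qed

lemma slit_image_cases:
  assumes "c \<in> charts M" "z \<in> slit_image M c"
  obtains p v where "(p, v) \<in> chart_dom (slit_tangent M) c" "z = (coord M c p, v c)"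
  using assms unfolding slit_image_def by fastforce

text \<open>On \<open>overlap c d\<close> times the nonzero vectors the transition map is the
  tangent map \<open>\<Phi>\<close>. The second differential in its fibre component is the source of
  the inhomogeneous term in \<open>coeff_transform\<close>.\<close>

lemma slit_transition_derivative:
  assumes c: "c \<in> charts M" "p \<in> chart_dom M c" and d: "d \<in> charts M" "p \<in> chart_dom M d" and y: "y \<noteq> 0"
  shows "frechet_derivative (transition (slit_tangent M) c d) (at (coord M c p, y)) (a, b) =
    (jac c d (coord M c p) a, frechet_derivative (\<lambda>x. jac c d x y) (at (coord M c p)) a + jac c d (coord M c p) b)"
proof -
  interpret cd: coordinate_change "overlap c d" "transition M c d"
    using c d coordinate_change_overlap by blast
  have x: "coord M c p \<in> overlap c d" using c d by (auto simp: overlap_def)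
  have "frechet_derivative (transition (slit_tangent M) c d) (at (coord M c p, y)) =
      frechet_derivative cd.\<Phi> (at (coord M c p, y))"
  proof (rule frechet_cong[where S = "overlap c d \<times> (- {0})"])
    fix z :: "(real^'n) \<times> (real^'n)" assume "z \<in> overlap c d \<times> (- {0})"
    then obtain q y where q: "q \<in> chart_dom M c" "q \<in> chart_dom M d" "z = (coord M c q, y)" "y \<noteq> 0"
      by (auto simp: overlap_def)
    obtain v where v: "(q, v) \<in> chart_dom (slit_tangent M) c" "v c = y" using slit_vector c q by metis
    then have e: "chart_inv (slit_tangent M) c z = (q, v)" using slit_chart_inv[OF c(1) v(1)] q by simp
    have "transition (slit_tangent M) c d z = (coord M d q, v d)"
      by (simp add: transition_def e)
    also have "v d = cd.J (coord M c q) y"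
      using slit_vector_transform[OF c(1) d(1) v(1), unfolded v(2)] v(1) q(2) unfolding cd.J_def by simp
    also have "coord M d q = transition M c d (coord M c q)"
      by (rule transition_coord[OF c(1) q(1), symmetric])
    finally show "transition (slit_tangent M) c d z = cd.\<Phi> z"
      by (simp add: q(3) cd.\<Phi>_def)
  qed (use x y cd.open_W in \<open>auto intro!: open_Times open_Compl\<close>)
  then show ?thesis using frechet_eqI[OF cd.\<Phi>_deriv[OF x]] by (simp add: cd.K_def cd.J_def)
qed

lemma jac_inverse:
  assumes c: "c \<in> charts M" "p \<in> chart_dom M c" and d: "d \<in> charts M" "p \<in> chart_dom M d"
  shows "jac d c (coord M d p) (jac c d (coord M c p) w) = w"
  unfolding jac_compose[OF c d c, symmetric] by (rule jac_self[OF c])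

end

section \<open>The spray associated with a volume form\<close>

locale spray_volume = manifold M for M :: "('p, 'c, real^'n) atlas" +
  fixes G :: "'p \<times> ('c \<Rightarrow> real^'n) \<Rightarrow> 'c \<Rightarrow> (real^'n) \<times> (real^'n)"
    and dV :: "'p \<Rightarrow> 'c \<Rightarrow> real"
  assumes spray: "spray M G" and volume: "volume_form M dV"
begin

section \<open>Transformation of the spray coefficients and invariance of S\<close>

lemma local_rep_G:
  "c \<in> charts M \<Longrightarrow> u \<in> chart_dom (slit_tangent M) c \<Longrightarrow>
    local_rep (slit_tangent M) G c (coord (slit_tangent M) c u) = G u c"
  by (simp add: local_rep_def slit_chart_inv)

lemma smooth_local_rep_G: "c \<in> charts M \<Longrightarrow> smooth_on (slit_image M c) (local_rep (slit_tangent M) G c)"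
  using spray by (simp add: spray_def vector_field_def slit_image_def)

lemma smooth_coeff: "c \<in> charts M \<Longrightarrow> smooth_on (slit_image M c) (spray_coeff M G c)"
  unfolding spray_coeff_def[abs_def]
  by (intro smooth_on_linear_compose[OF bounded_linear_scaleR_right] smooth_on_linear_compose[OF bounded_linear_snd]
      open_slit_image smooth_local_rep_G)

lemma G_eq:
  assumes c: "c \<in> charts M" and u: "(p, v) \<in> chart_dom (slit_tangent M) c"
  shows "G (p, v) c = (v c, - 2 *\<^sub>R spray_coeff M G c (coord M c p, v c))"
proof -
  have z: "(coord M c p, v c) \<in> slit_image M c" unfolding slit_image_def using u by (intro image_eqI[of _ _ "(p, v)"]) auto
  have e: "local_rep (slit_tangent M) G c (coord M c p, v c) = G (p, v) c" using local_rep_G[OF c u] by simp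
  have "fst (local_rep (slit_tangent M) G c (coord M c p, v c)) = v c"
    using spray c z by (auto simp: spray_def)
  then have "fst (G (p, v) c) = v c" unfolding e .
  then show ?thesis unfolding spray_coeff_def e by (cases "G (p, v) c") simp
qed

lemma slit_image_scale: "c \<in> charts M \<Longrightarrow> (x, y) \<in> slit_image M c \<Longrightarrow> l > 0 \<Longrightarrow> (x, l *\<^sub>R y) \<in> slit_image M c"
  by (simp add: slit_image_eq)

lemma coeff_scale:
  "c \<in> charts M \<Longrightarrow> (x, y) \<in> slit_image M c \<Longrightarrow> l > 0 \<Longrightarrow>
    spray_coeff M G c (x, l *\<^sub>R y) = l\<^sup>2 *\<^sub>R spray_coeff M G c (x, y)"
  using spray unfolding spray_def by fastforce

text \<open>This is the fibre component of the tangency of G, with (a, b) = (y, -2 G) in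
  \<open>slit_transition_derivative\<close>: the base component y enters the second differential,
  which makes that term quadratic in y.\<close>

lemma coeff_transform:
  assumes c: "c \<in> charts M" "p \<in> chart_dom M c" and d: "d \<in> charts M" "p \<in> chart_dom M d" and y: "y \<noteq> 0"
  shows "- 2 *\<^sub>R spray_coeff M G d (coord M d p, jac c d (coord M c p) y) =
     frechet_derivative (\<lambda>x. jac c d x y) (at (coord M c p)) y
     - 2 *\<^sub>R jac c d (coord M c p) (spray_coeff M G c (coord M c p, y))"
proof -
  obtain v where v: "(p, v) \<in> chart_dom (slit_tangent M) c" "v c = y" using slit_vector c y by metis
  then have vd: "(p, v) \<in> chart_dom (slit_tangent M) d" using d by simp
  have "G (p, v) \<in> tangent_space (slit_tangent M) (p, v)"
    using spray v by (auto simp: spray_def vector_field_def)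
  then have "G (p, v) d = frechet_derivative (transition (slit_tangent M) c d) (at (coord M c p, y)) (G (p, v) c)"
    using tangent_space_transform[of "G (p, v)" "slit_tangent M" "(p, v)" c d] v vd c d by simp
  then have "snd (G (p, v) d) = frechet_derivative (\<lambda>x. jac c d x y) (at (coord M c p)) y
     + jac c d (coord M c p) (- 2 *\<^sub>R spray_coeff M G c (coord M c p, y))"
    using slit_transition_derivative[OF c d y] G_eq[OF c(1) v(1)] v(2) by simp
  moreover have "v d = jac c d (coord M c p) y" by (rule slit_vector_transform[OF c(1) d(1) v(1) vd, unfolded v(2)])
  ultimately show ?thesis using G_eq[OF d(1) vd] linear_cmul[OF linear_jac[OF c(1) d(1) c(2) d(2)], of "- 2"] by simp
qed

lemma dV_local: "c \<in> charts M \<Longrightarrow> p \<in> chart_dom M c \<Longrightarrow> local_rep M dV c (coord M c p) = dV p c"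
  by (simp add: local_rep_def chart_inv_coord)

lemmas volume_conjuncts = volume[unfolded volume_form_def, THEN conjunct1]
  volume[unfolded volume_form_def, THEN conjunct2, THEN conjunct1]
  volume[unfolded volume_form_def, THEN conjunct2, THEN conjunct2]

lemma smooth_dV: "c \<in> charts M \<Longrightarrow> smooth_on (coord M c ` chart_dom M c) (local_rep M dV c)"
  by (rule bspec[OF volume_conjuncts(3)])

lemma dV_transform:
  assumes "c \<in> charts M" "d \<in> charts M" "p \<in> chart_dom M c" "p \<in> chart_dom M d"
  shows "dV p c = \<bar>det (matrix (jac c d (coord M c p)))\<bar> * dV p d"
  by (rule volume_conjuncts(2)[rule_format]) (use assms in auto)

lemma dV_pos:
  assumes "c \<in> charts M" "x \<in> coord M c ` chart_dom M c"
  shows "local_rep M dV c x > 0"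
proof -
  obtain p where p: "p \<in> chart_dom M c" "x = coord M c p" using assms(2) by blast
  show ?thesis unfolding p(2) dV_local[OF assms(1) p(1)]
    by (rule volume_conjuncts(1)[rule_format, OF assms(1) p(1)])
qed

lemma S_curvature_invariant:
  assumes c: "c \<in> charts M" and d: "d \<in> charts M"
    and uc: "(p, v) \<in> chart_dom (slit_tangent M) c" and ud: "(p, v) \<in> chart_dom (slit_tangent M) d"
  shows "S_curvature M G dV c (coord M c p, v c) = S_curvature M G dV d (coord M d p, v d)"
proof -
  interpret cd: coordinate_change "overlap c d" "transition M c d"
    using c d coordinate_change_overlap by blast
  have p: "p \<in> chart_dom M c" "p \<in> chart_dom M d" using uc ud by auto
  have x: "coord M c p \<in> overlap c d" using p by (auto simp: overlap_def)
  have y: "v c \<noteq> 0" "v d \<noteq> 0" using tangent_nonzero uc ud c d by auto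
  have vd: "v d = cd.J (coord M c p) (v c)" unfolding cd.J_def by (rule slit_vector_transform[OF c d uc ud])
  have T: "transition M c d (coord M c p) = coord M d p" using transition_coord c p by simp
  have zc: "(coord M c p, v c) \<in> slit_image M c" "(coord M d p, v d) \<in> slit_image M d"
    using c d p y by (auto simp: slit_image_eq)
  show ?thesis
    unfolding S_curvature_def case_prod_conv
    unfolding vd T[symmetric]
  proof (rule cd.S_invariant[OF x y(1), where L = "jac d c (coord M d p)"])
    show "jac d c (coord M d p) (cd.J (coord M c p) w) = w" for w
      using jac_inverse c d p by (simp add: cd.J_def)
    show "linear (jac d c (coord M d p))" using linear_jac c d p by simp
    show "spray_coeff M G c differentiable (at (coord M c p, v c))"
      using smooth_on_has_derivative[OF smooth_coeff[OF c] zc(1)] differentiable_def by blast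
    show "spray_coeff M G d differentiable (at (transition M c d (coord M c p), cd.J (coord M c p) (v c)))"
      using smooth_on_has_derivative[OF smooth_coeff[OF d] zc(2)] differentiable_def unfolding T vd by blast
    show "- 2 *\<^sub>R spray_coeff M G d (transition M c d (coord M c p), cd.J (coord M c p) y) =
        cd.K (coord M c p) y y - 2 *\<^sub>R cd.J (coord M c p) (spray_coeff M G c (coord M c p, y))" if "y \<noteq> 0" for y
      using coeff_transform[OF c p(1) d p(2) that] unfolding T by (simp add: cd.J_def cd.K_def)
    show "local_rep M dV c x = \<bar>det (matrix (cd.J x))\<bar> * local_rep M dV d (transition M c d x)" if xo: "x \<in> overlap c d" for x
    proof -
      obtain q where q: "q \<in> chart_dom M c" "q \<in> chart_dom M d" "x = coord M c q" using xo by (auto simp: overlap_def)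
      then show ?thesis
        using dV_transform[OF c d q(1,2)] c d by (simp add: dV_local transition_coord cd.J_def)
    qed
    show "local_rep M dV c x > 0" if "x \<in> overlap c d" for x
      using that dV_pos[OF c] by (auto simp: overlap_def)
    show "local_rep M dV d differentiable (at (transition M c d (coord M c p)))"
      using smooth_on_has_derivative[OF smooth_dV[OF d]] p(2) differentiable_def unfolding T by blast
  qed
qed

section \<open>Smoothness and homogeneity of the local data\<close>

text \<open>ln \<sigma> pulled back to pairs (x, y), so that \<open>dx\<close> and \<open>dy\<close>
  apply; it serves as f in \<open>isotropic_of_projective_change\<close>.\<close>

definition logvol where "logvol c z = ln (local_rep M dV c (fst z))" for c and z :: "(real^'n) \<times> (real^'n)"

lemma fst_slit_image: "c \<in> charts M \<Longrightarrow> z \<in> slit_image M c \<Longrightarrow> fst z \<in> coord M c ` chart_dom M c"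
  by (auto simp: slit_image_eq)

lemma smooth_ln_dV: "c \<in> charts M \<Longrightarrow> smooth_on (coord M c ` chart_dom M c) (\<lambda>x. ln (local_rep M dV c x))"
  using dV_pos by (intro smooth_on_ln open_chart smooth_dV) auto

lemma smooth_logvol: "c \<in> charts M \<Longrightarrow> smooth_on (slit_image M c) (logvol c)"
  unfolding logvol_def[abs_def] using fst_slit_image
  by (intro smooth_on_compose_linear[OF bounded_linear_fst open_chart open_slit_image _ smooth_ln_dV]) auto

lemma logvol_derivative:
  assumes c: "c \<in> charts M" and z: "z \<in> slit_image M c"
  shows "frechet_derivative (logvol c) (at z) v = frechet_derivative (\<lambda>x. ln (local_rep M dV c x)) (at (fst z)) (fst v)"
proof -
  have "(fst has_derivative fst) (at z)" by (rule bounded_linear_imp_has_derivative[OF bounded_linear_fst])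
  from has_derivative_compose[OF this smooth_on_has_derivative[OF smooth_ln_dV[OF c] fst_slit_image[OF c z]]]
  have "(logvol c has_derivative (\<lambda>v. frechet_derivative (\<lambda>x. ln (local_rep M dV c x)) (at (fst z)) (fst v))) (at z)"
    unfolding logvol_def[abs_def] .
  from fun_cong[OF frechet_eqI[OF this], of v] show ?thesis .
qed

lemma S_curvature_eq:
  assumes c: "c \<in> charts M" and z: "z \<in> slit_image M c"
  shows "S_curvature M G dV c z = (\<Sum>m\<in>UNIV. dy m (\<lambda>z. spray_coeff M G c z $ m) z) - (\<Sum>m\<in>UNIV. snd z $ m * dx m (logvol c) z)"
  unfolding dx_def logvol_derivative[OF c z] by (simp add: S_curvature_def case_prod_unfold)

lemma slit_calculus: "c \<in> charts M \<Longrightarrow> slit_calculus (slit_image M c)"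
  by unfold_locales (rule open_slit_image)

lemma smooth_coeff_component: "c \<in> charts M \<Longrightarrow> smooth_on (slit_image M c) (\<lambda>z. spray_coeff M G c z $ i)"
  by (intro smooth_on_linear_compose[OF bounded_linear_vec_nth] open_slit_image smooth_coeff)

lemma smooth_S: assumes c: "c \<in> charts M" shows "smooth_on (slit_image M c) (S_curvature M G dV c)"
proof -
  interpret slit_calculus "slit_image M c" by (rule slit_calculus[OF c])
  have "sm (\<lambda>z. (\<Sum>m\<in>UNIV. dy m (\<lambda>z. spray_coeff M G c z $ m) z) - (\<Sum>m\<in>UNIV. snd z $ m * dx m (logvol c) z))"
    using smooth_coeff_component[OF c] smooth_logvol[OF c] by simp
  then show ?thesis using smooth_on_cong[OF open_U] S_curvature_eq[OF c] by (metis (no_types, lifting))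
qed

text \<open>Euler's theorem: differentiate g (x, t y) = t^2 g (x, y) in t at t = 1.\<close>

lemma coeff_homogeneous:
  assumes c: "c \<in> charts M"
  shows "slit_calculus.homogeneous (slit_image M c) 2 (\<lambda>z. spray_coeff M G c z $ i)"
proof -
  interpret slit_calculus "slit_image M c" by (rule slit_calculus[OF c])
  let ?g = "\<lambda>z. spray_coeff M G c z $ i"
  have "(\<Sum>k\<in>UNIV. y $ k * dy k ?g (x, y)) = 2 * ?g (x, y)" if z: "(x, y) \<in> slit_image M c" for x y
  proof -
    note D = smooth_on_has_derivative[OF smooth_coeff_component[OF c, of i] z]
    have "((\<lambda>t. (x, t *\<^sub>R y)) has_derivative (\<lambda>t. (0, t *\<^sub>R y))) (at 1)"
      by (auto intro!: derivative_eq_intros)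
    from has_derivative_compose[OF this, of ?g] D
    have "((\<lambda>t. ?g (x, t *\<^sub>R y)) has_derivative (\<lambda>t. frechet_derivative ?g (at (x, y)) (0, t *\<^sub>R y))) (at 1)" by simp
    then have 1: "((\<lambda>t. t\<^sup>2 * ?g (x, y)) has_derivative (\<lambda>t. frechet_derivative ?g (at (x, y)) (0, t *\<^sub>R y))) (at 1)"
      by (rule has_derivative_transform_within_open[where s = "{0<..}"]) (auto simp: coeff_scale[OF c z])
    have 2: "((\<lambda>t. t\<^sup>2 * ?g (x, y)) has_derivative (\<lambda>t. 2 * t * ?g (x, y))) (at 1)"
      by (auto intro!: derivative_eq_intros)
    have "frechet_derivative ?g (at (x, y)) (0, 1 *\<^sub>R y) = 2 * 1 * ?g (x, y)"
      using fun_cong[OF has_derivative_unique[OF 1 2]] .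
    moreover have "frechet_derivative ?g (at (x, y)) (0, y) = (\<Sum>k\<in>UNIV. y $ k *\<^sub>R frechet_derivative ?g (at (x, y)) (0, axis k 1))"
    proof (rule linear_axis_sum[of "\<lambda>w. frechet_derivative ?g (at (x, y)) (0, w)"])
      have "linear (\<lambda>w::real^'n. (0::real^'n, w))" by (auto intro!: linearI)
      from linear_compose[OF this has_derivative_linear[OF D]]
      show "linear (\<lambda>w. frechet_derivative ?g (at (x, y)) (0, w))" by (simp add: o_def)
    qed
    ultimately show ?thesis by (simp add: dy_def)
  qed
  then show ?thesis using smooth_coeff_component[OF c] by (auto simp: homogeneous_def)
qed

text \<open>A spray is defined by scaling and not by Euler's identity, so the degree of S is
  obtained from the scaling law itself: the chain rule for (x, y) \<mapsto> (x, l y) produces a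
  factor l on one side against l^2 on the other.\<close>

lemma dy_coeff_scale:
  assumes c: "c \<in> charts M" and z: "(x, y) \<in> slit_image M c" and l: "l > 0"
  shows "dy m (\<lambda>z. spray_coeff M G c z $ i) (x, l *\<^sub>R y) = l * dy m (\<lambda>z. spray_coeff M G c z $ i) (x, y)"
proof -
  let ?g = "\<lambda>z. spray_coeff M G c z $ i"
  note D = smooth_on_has_derivative[OF smooth_coeff_component[OF c, of i] z]
  note Dl = smooth_on_has_derivative[OF smooth_coeff_component[OF c, of i] slit_image_scale[OF c z l]]
  have "((\<lambda>z. (fst z, l *\<^sub>R snd z)) has_derivative (\<lambda>v. (fst v, l *\<^sub>R snd v))) (at (x, y))"
    by (auto intro!: derivative_eq_intros)
  from has_derivative_compose[OF this, of ?g] Dl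
  have "((\<lambda>z. ?g (fst z, l *\<^sub>R snd z)) has_derivative (\<lambda>v. frechet_derivative ?g (at (x, l *\<^sub>R y)) (fst v, l *\<^sub>R snd v))) (at (x, y))"
    by simp
  then have 1: "((\<lambda>z. l\<^sup>2 * ?g z) has_derivative (\<lambda>v. frechet_derivative ?g (at (x, l *\<^sub>R y)) (fst v, l *\<^sub>R snd v))) (at (x, y))"
    by (rule has_derivative_transform_within_open[OF _ open_slit_image[OF c] z]) (auto simp: coeff_scale[OF c _ l])
  have 2: "((\<lambda>z. l\<^sup>2 * ?g z) has_derivative (\<lambda>v. l\<^sup>2 * frechet_derivative ?g (at (x, y)) v)) (at (x, y))"
    by (rule has_derivative_mult_right[OF D])
  have "frechet_derivative ?g (at (x, l *\<^sub>R y)) (0, l *\<^sub>R axis m 1) = l\<^sup>2 * frechet_derivative ?g (at (x, y)) (0, axis m 1)"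
    using fun_cong[OF has_derivative_unique[OF 1 2], of "(0, axis m 1)"] by simp
  moreover have "frechet_derivative ?g (at (x, l *\<^sub>R y)) (0, l *\<^sub>R axis m 1) = l * frechet_derivative ?g (at (x, l *\<^sub>R y)) (0, axis m 1)"
    using linear_cmul[OF has_derivative_linear[OF Dl], of l "(0, axis m 1)"] by simp
  ultimately show ?thesis using l by (simp add: dy_def power2_eq_square)
qed

lemma S_scale:
  assumes c: "c \<in> charts M" and z: "(x, y) \<in> slit_image M c" and l: "l > 0"
  shows "S_curvature M G dV c (x, l *\<^sub>R y) = l * S_curvature M G dV c (x, y)"
  by (simp add: S_curvature_def dy_coeff_scale[OF c z l] right_diff_distrib sum_distrib_left mult.assoc)

section \<open>The associated spray\<close>

lemma associated_local:
  assumes c: "c \<in> charts M" and z: "z \<in> slit_image M c"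
  shows "local_rep (slit_tangent M) (associated_spray M G dV) c z =
    (snd z, - 2 *\<^sub>R (spray_coeff M G c z - (S_curvature M G dV c z / (real CARD('n) + 1)) *\<^sub>R snd z))"
proof -
  obtain p v where u: "(p, v) \<in> chart_dom (slit_tangent M) c" "z = coord (slit_tangent M) c (p, v)"
    using slit_image_cases[OF c z] by auto
  show ?thesis unfolding u(2) local_rep_def slit_chart_inv[OF c u(1)] associated_spray_def
    using u(1) c by (simp add: Let_def)
qed

lemma associated_coeff:
  assumes c: "c \<in> charts M" and z: "z \<in> slit_image M c"
  shows "spray_coeff M (associated_spray M G dV) c z =
    spray_coeff M G c z - (S_curvature M G dV c z / (real CARD('n) + 1)) *\<^sub>R snd z"
  by (simp add: spray_coeff_def[of M "associated_spray M G dV"] associated_local[OF c z])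

text \<open>The two sprays differ by a multiple of the Liouville field, with components (0, y).
  Together with the invariance of S this reduces tangency of the associated spray to that of
  G.\<close>

lemma associated_eq:
  assumes c: "c \<in> charts M" and u: "(p, v) \<in> chart_dom (slit_tangent M) c"
  shows "associated_spray M G dV (p, v) c =
    G (p, v) c + (0, (2 * S_curvature M G dV c (coord M c p, v c) / (real CARD('n) + 1)) *\<^sub>R v c)"
proof -
  have "associated_spray M G dV (p, v) c = (v c, - 2 *\<^sub>R (spray_coeff M G c (coord M c p, v c)
      - (S_curvature M G dV c (coord M c p, v c) / (real CARD('n) + 1)) *\<^sub>R v c))"
    unfolding associated_spray_def using u c by (simp add: Let_def)
  then show ?thesis by (simp add: G_eq[OF c u] scaleR_diff_right)
qed

lemma associated_tangent:
  assumes "(p, v) \<in> points (slit_tangent M)"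
  shows "associated_spray M G dV (p, v) \<in> tangent_space (slit_tangent M) (p, v)"
proof -
  have 1: "associated_spray M G dV (p, v) d = frechet_derivative (transition (slit_tangent M) c d)
      (at (coord M c p, v c)) (associated_spray M G dV (p, v) c)"
    if c: "c \<in> charts M" "(p, v) \<in> chart_dom (slit_tangent M) c" and d: "d \<in> charts M" "(p, v) \<in> chart_dom (slit_tangent M) d" for c d
  proof -
    have pc: "p \<in> chart_dom M c" and pd: "p \<in> chart_dom M d" using c d by auto
    have y: "v c \<noteq> 0" using tangent_nonzero c by auto
    let ?s = "2 * S_curvature M G dV c (coord M c p, v c) / (real CARD('n) + 1)"
    note D = slit_transition_derivative[OF c(1) pc d(1) pd y]
    note lin = linear_jac[OF c(1) d(1) pc pd]
    obtain a b where ab: "G (p, v) c = (a, b)" by fastforce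
    have "G (p, v) \<in> tangent_space (slit_tangent M) (p, v)"
      using spray assms by (auto simp: spray_def vector_field_def)
    then have "G (p, v) d = frechet_derivative (transition (slit_tangent M) c d) (at (coord M c p, v c)) (a, b)"
      using tangent_space_transform[of "G (p, v)" "slit_tangent M" "(p, v)" c d] c d ab by simp
    moreover have "v d = jac c d (coord M c p) (v c)" by (rule slit_vector_transform[OF c(1) d(1) c(2) d(2)])
    \<comment> \<open>The fibre component of the differential depends on b through J b alone, so
      adding s y to b adds s J y, which is s times the component of v in d; S has the same value in
      both charts.\<close>
    ultimately show ?thesis
      using S_curvature_invariant[OF c(1) d(1) c(2) d(2)]
      unfolding associated_eq[OF c] associated_eq[OF d] ab
      by (simp add: D linear_add[OF lin] linear_cmul[OF lin])
  qed
  have 0: "associated_spray M G dV (p, v) c = 0" if "c \<notin> charts M \<or> (p, v) \<notin> chart_dom (slit_tangent M) c" for c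
    unfolding associated_spray_def using that by (intro if_not_P) blast
  show ?thesis unfolding tangent_space_def
  proof (intro CollectI conjI ballI allI impI)
    fix c d assume "c \<in> charts (slit_tangent M)" "d \<in> charts (slit_tangent M)"
      "(p, v) \<in> chart_dom (slit_tangent M) c \<inter> chart_dom (slit_tangent M) d"
    then show "associated_spray M G dV (p, v) d = frechet_derivative (transition (slit_tangent M) c d)
      (at (coord (slit_tangent M) c (p, v))) (associated_spray M G dV (p, v) c)"
      unfolding slit_coord slit_charts by (intro 1) blast+
  qed (unfold slit_charts, rule 0)
qed

lemma spray_associated: "spray M (associated_spray M G dV)"
proof -
  have "smooth_on (slit_image M c) (local_rep (slit_tangent M) (associated_spray M G dV) c)" if c: "c \<in> charts M" for c
  proof -
    let ?r = "\<lambda>z. (snd z, - 2 *\<^sub>R (spray_coeff M G c z - ((1 / (real CARD('n) + 1)) * S_curvature M G dV c z) *\<^sub>R snd z))"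
    have "smooth_on (slit_image M c) ?r"
      by (intro smooth_on_Pair smooth_on_scaleR smooth_on_mult smooth_on_diff smooth_on_const
          smooth_on_bounded_linear[OF bounded_linear_snd] open_slit_image smooth_coeff smooth_S c)
    moreover have "smooth_on (slit_image M c) (local_rep (slit_tangent M) (associated_spray M G dV) c) \<longleftrightarrow>
        smooth_on (slit_image M c) ?r"
      by (rule smooth_on_cong[OF open_slit_image[OF c]]) (simp add: associated_local[OF c])
    ultimately show ?thesis by blast
  qed
  then have "vector_field (slit_tangent M) (associated_spray M G dV)"
    using associated_tangent by (auto simp: vector_field_def slit_image_def)
  moreover have "fst (local_rep (slit_tangent M) (associated_spray M G dV) c (x, y)) = y"
    if "c \<in> charts M" "(x, y) \<in> slit_image M c" for c x y
    using associated_local[OF that] by simp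
  moreover have "spray_coeff M (associated_spray M G dV) c (x, l *\<^sub>R y) = l\<^sup>2 *\<^sub>R spray_coeff M (associated_spray M G dV) c (x, y)"
    if c: "c \<in> charts M" and z: "(x, y) \<in> slit_image M c" and l: "l > 0" for c x y l
    using associated_coeff[OF c z] associated_coeff[OF c slit_image_scale[OF c z l]] S_scale[OF c z l] coeff_scale[OF c z l]
    by (simp add: scaleR_diff_right power2_eq_square)
  ultimately show ?thesis unfolding spray_def by blast
qed

lemma isotropic_associated:
  assumes "scalar_curvature M G" "CARD('n) \<ge> 2"
  shows "isotropic_curvature M (associated_spray M G dV)"
proof -
  have "riemann2 (spray_coeff M (associated_spray M G dV) c) i k z =
      ricci_scalar (spray_coeff M (associated_spray M G dV) c) z * (if i = k then 1 else 0)
      - 1 / 2 * dy k (ricci_scalar (spray_coeff M (associated_spray M G dV) c)) z * snd z $ i"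
    if c: "c \<in> charts M" and z: "z \<in> slit_image M c" for c z i k
  proof -
    interpret slit_calculus "slit_image M c" by (rule slit_calculus[OF c])
    show ?thesis
    proof (rule isotropic_of_projective_change[where G = "spray_coeff M G c" and f = "logvol c" and S = "S_curvature M G dV c"])
      show "homogeneous 2 (\<lambda>z. spray_coeff M G c z $ i)" for i by (rule coeff_homogeneous[OF c])
      show "snd z \<noteq> 0" if "z \<in> slit_image M c" for z using that by (auto simp: slit_image_eq[OF c])
      show "\<exists>\<tau>. \<forall>i k. riemann2 (spray_coeff M G c) i k z =
          ricci_scalar (spray_coeff M G c) z * (if i = k then 1 else 0) - \<tau> k * snd z $ i" if "z \<in> slit_image M c" for z
      proof -
        obtain \<tau> :: "'n \<Rightarrow> (real^'n) \<times> (real^'n) \<Rightarrow> real" where \<tau>: "\<forall>(x, y)\<in>slit_image M c.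
            (\<forall>k. \<forall>l>0. \<tau> k (x, l *\<^sub>R y) = l * \<tau> k (x, y)) \<and>
            (\<Sum>k\<in>UNIV. \<tau> k (x, y) * y $ k) = ricci_scalar (spray_coeff M G c) (x, y) \<and>
            (\<forall>i k. riemann2 (spray_coeff M G c) i k (x, y) =
               ricci_scalar (spray_coeff M G c) (x, y) * (if i = k then 1 else 0) - \<tau> k (x, y) * y $ i)"
          using assms(1)[unfolded scalar_curvature_def, THEN bspec, OF c] by (rule exE)
        from bspec[OF \<tau> that]
        have "\<forall>i k. riemann2 (spray_coeff M G c) i k z =
          ricci_scalar (spray_coeff M G c) z * (if i = k then 1 else 0) - \<tau> k z * snd z $ i"
          by (cases z) (simp only: case_prod_conv snd_conv simp_thms)
        then show ?thesis by (rule exI[of _ "\<lambda>k. \<tau> k z"])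
      qed
      \<comment> \<open>The direction (0, axis k 1) has base component 0, and
        \<open>logvol c\<close> is differentiated through its base point only.\<close>
      show "dy k (logvol c) z = 0" if "z \<in> slit_image M c" for z k
        unfolding dy_def logvol_derivative[OF c that]
        using linear_0[OF has_derivative_linear[OF smooth_on_has_derivative[OF smooth_ln_dV[OF c] fst_slit_image[OF c that]]]] by simp
    qed (fact assms(2) smooth_logvol[OF c] S_curvature_eq[OF c] associated_coeff[OF c] z)+
  qed
  from this[where z = "(x, y)" for x y, unfolded snd_conv] show ?thesis
    unfolding isotropic_curvature_def by blast
qed

end

theorem corollary1p2:
  fixes M :: "('p, 'c, real^'n) atlas"
    and G :: "'p \<times> ('c \<Rightarrow> real^'n) \<Rightarrow> 'c \<Rightarrow> (real^'n) \<times> (real^'n)"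
    and dV :: "'p \<Rightarrow> 'c \<Rightarrow> real"
  assumes "CARD('n) \<ge> 2"
    and "smooth_manifold M"
    and "spray M G"
    and "scalar_curvature M G"
    and "volume_form M dV"
  shows "spray M (associated_spray M G dV) \<and>
         isotropic_curvature M (associated_spray M G dV)"
proof -
  interpret spray_volume M G dV using assms by unfold_locales
  show ?thesis using spray_associated isotropic_associated assms by blast
qed

end
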